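(* Let $(M,\tau)$ be a tracial $W^\ast$-probability space, let $X_1,\dots,X_n\in M$ be self-adjoint, and assume that there are elements $\xi_1,\dots,\xi_n\in L^2(M,\tau)$ such that $(\xi_1,\dots,\xi_n)$ satisfies the conjugate relations for $(X_1,\dots,X_n)$, i.e. for every $P\in\mathbb{C}\langle Z_1,\dots,Z_n\rangle$ and every $j=1,\dots,n$, $$(\tau\otimes\tau)\big((\partial_jP)(X_1,\dots,X_n)\big)=\tau\big(\xi_j\,P(X_1,\dots,X_n)\big).$$ Then: (a) $X_1,\dots,X_n$ do not satisfy any non-trivial algebraic relation, i.e. there exists no non-zero polynomial $P\in\mathbb{C}\langle Z_1,\dots,Z_n\rangle$ such that $P(X_1,\dots,X_n)=0$. (b) For each $j=1,\dots,n$, there is a unique derivation $$\hat\partial_j:\ \mathbb{C}\langle X_1,\dots,X_n\rangle\to\mathbb{C}\langle X_1,\dots,X_n\rangle\otimes\mathbb{C}\langle X_1,\dots,X_n\rangle$$ which satisfies $\hat\partial_j(X_i)=\delta_{j,i}\,1\otimes1$ for $i=1,\dots,n$.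
   Context: A tracial $W^\ast$-probability space $(M,\tau)$ is a von Neumann algebra $M$ with a faithful normal tracial state $\tau$. $L^2(M,\tau)$ is the completion of $M$ for the inner product $\langle a,b\rangle=\tau(ab^* )$; for $\xi\in L^2(M,\tau)$ and $a\in M$, $\tau(\xi a):=\langle \xi,a^*\rangle$. $\mathbb{C}\langle Z_1,\dots,Z_n\rangle$ is the unital $\ast$-algebra of non-commutative polynomials in $n$ self-adjoint formal variables. For $j=1,\dots,n$, $\partial_j:\mathbb{C}\langle Z_1,\dots,Z_n\rangle\to\mathbb{C}\langle Z_1,\dots,Z_n\rangle\otimes\mathbb{C}\langle Z_1,\dots,Z_n\rangle$ (algebraic tensor product) is the unique derivation with $\partial_jZ_i=\delta_{i,j}\,1\otimes1$; on a monomial $P$, $\partial_jP=\sum_{P=P_1Z_jP_2}P_1\otimes P_2$, the sum being over all factorizations of $P$ with monomials $P_1,P_2$. A derivation from a unital algebra $\mathcal{A}$ to an $\mathcal{A}$-bimodule is a linear map $\delta$ with $\delta(ab)=\delta(a)\cdot b+a\cdot\delta(b)$; the bimodule structure on $\mathcal{A}\otimes\mathcal{A}$ is $a\cdot(b\otimes c)\cdot d=(ab)\otimes(cd)$. For self-adjoint $X=(X_1,\dots,X_n)\in M^n$, $P(X)$ denotes the image of $P$ under the unital homomorphism $\mathrm{ev}_X:\mathbb{C}\langle Z_1,\dots,Z_n\rangle\to M$, $Z_i\mapsto X_i$; its range is denoted $\mathbb{C}\langle X_1,\dots,X_n\rangle\subset M$. For $Q\in\mathbb{C}\langle Z_1,\dots,Z_n\rangle^{\otimes2}$,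 $Q(X):=(\mathrm{ev}_X\otimes\mathrm{ev}_X)(Q)$. *)

theory Defs
  imports "HOL-Analysis.Analysis" "HOL-Library.Poly_Mapping"
begin

section \<open>Complex vector spaces and Hilbert spaces\<close>

class complex_vector = ab_group_add +
  fixes scaleC :: "complex \<Rightarrow> 'a \<Rightarrow> 'a"  (infixr \<open>*\<^sub>C\<close> 75)
  assumes scaleC_add_right: "c *\<^sub>C (x + y) = c *\<^sub>C x + c *\<^sub>C y"
    and scaleC_add_left: "(c + d) *\<^sub>C x = c *\<^sub>C x + d *\<^sub>C x"
    and scaleC_scaleC: "c *\<^sub>C d *\<^sub>C x = (c * d) *\<^sub>C x"
    and scaleC_one: "1 *\<^sub>C x = x"

global_interpretation complex_vector:
  vector_space "scaleC :: complex \<Rightarrow> 'a \<Rightarrow> 'a::complex_vector"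
  by standard (fact scaleC_add_right scaleC_add_left scaleC_scaleC scaleC_one)+

instantiation complex :: complex_vector
begin
definition scaleC_complex :: "complex \<Rightarrow> complex \<Rightarrow> complex"
  where "scaleC_complex c x = c * x"
instance
  by standard (simp_all add: scaleC_complex_def algebra_simps)
end

instantiation poly_mapping :: (type, complex_vector) complex_vector
begin
lift_definition scaleC_poly_mapping :: "complex \<Rightarrow> ('a \<Rightarrow>\<^sub>0 'b) \<Rightarrow> ('a \<Rightarrow>\<^sub>0 'b)"
  is "\<lambda>c f k. c *\<^sub>C f k"
  by (erule rev_finite_subset) auto
instance
  by (standard; transfer)
    (simp_all add: fun_eq_iff scaleC_add_right scaleC_add_left scaleC_scaleC)
end

class complex_algebra = complex_vector + ring + monoid_mult +
  assumes mult_scaleC_left: "(c *\<^sub>C x) * y = c *\<^sub>C (x * y)"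
    and mult_scaleC_right: "x * (c *\<^sub>C y) = c *\<^sub>C (x * y)"

(* The inner product is linear in its first argument, as in <a,b> = tau(a b^* ). *)
class complex_hilbert = complex_vector + banach +
  fixes cinner :: "'a \<Rightarrow> 'a \<Rightarrow> complex"
  assumes scaleR_scaleC: "r *\<^sub>R x = complex_of_real r *\<^sub>C x"
    and cinner_add_left: "cinner (x + y) z = cinner x z + cinner y z"
    and cinner_scaleC_left: "cinner (c *\<^sub>C x) y = c * cinner x y"
    and cinner_commute: "cinner y x = cnj (cinner x y)"
    and cinner_self: "cinner x x = complex_of_real ((norm x)\<^sup>2)"

lemma bounded_linear_scaleC: "bounded_linear ((*\<^sub>C) c :: 'h \<Rightarrow> 'h::complex_hilbert)"
proof (rule bounded_linear_intro[where K = "cmod c"])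
  fix x :: 'h
  have "cinner x (c *\<^sub>C x) = cnj (cinner (c *\<^sub>C x) x)"
    by (rule cinner_commute)
  also have "\<dots> = cnj c * cinner x x"
    by (simp add: cinner_scaleC_left cinner_self)
  finally have "cinner (c *\<^sub>C x) (c *\<^sub>C x) = (c * cnj c) * cinner x x"
    by (simp add: cinner_scaleC_left)
  then have "complex_of_real ((norm (c *\<^sub>C x))\<^sup>2) = complex_of_real ((cmod c * norm x)\<^sup>2)"
    by (simp only: cinner_self complex_norm_square[symmetric] power_mult_distrib of_real_mult)
  then have "(norm (c *\<^sub>C x))\<^sup>2 = (cmod c * norm x)\<^sup>2"
    by (simp only: of_real_eq_iff)
  then show "norm (c *\<^sub>C x) \<le> norm x * cmod c"
    by (simp add: mult.commute)
qed (simp_all add: scaleC_add_right scaleR_scaleC scaleC_scaleC mult.commute)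


section \<open>Bounded operators and von Neumann algebras\<close>

typedef (overloaded) 'h bop =
  "{f :: 'h \<Rightarrow> 'h::complex_hilbert. bounded_linear f \<and> (\<forall>c x. f (c *\<^sub>C x) = c *\<^sub>C f x)}"
  morphisms bop_apply Bop
  by (rule exI[of _ "\<lambda>x. x"]) (simp add: bounded_linear_ident)

setup_lifting type_definition_bop

instantiation bop :: (complex_hilbert) complex_algebra
begin

lift_definition zero_bop :: "'a bop" is "\<lambda>x. 0"
  by simp

lift_definition one_bop :: "'a bop" is "\<lambda>x. x"
  by (simp add: bounded_linear_ident)

lift_definition plus_bop :: "'a bop \<Rightarrow> 'a bop \<Rightarrow> 'a bop" is "\<lambda>f g x. f x + g x"
  by (simp add: bounded_linear_add scaleC_add_right)

lift_definition uminus_bop :: "'a bop \<Rightarrow> 'a bop" is "\<lambda>f x. - f x"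
  by (simp add: bounded_linear_minus)

lift_definition minus_bop :: "'a bop \<Rightarrow> 'a bop \<Rightarrow> 'a bop" is "\<lambda>f g x. f x - g x"
  by (simp add: bounded_linear_sub complex_vector.scale_right_diff_distrib)

lift_definition times_bop :: "'a bop \<Rightarrow> 'a bop \<Rightarrow> 'a bop" is "\<lambda>f g x. f (g x)"
  by (simp add: bounded_linear_compose)

lift_definition scaleC_bop :: "complex \<Rightarrow> 'a bop \<Rightarrow> 'a bop" is "\<lambda>c f x. c *\<^sub>C f x"
  by (auto simp: scaleC_scaleC mult.commute
      intro!: bounded_linear_compose[OF bounded_linear_scaleC])

instance
proof
  fix a b c :: "'a bop" and k l :: complex
  show "a + b + c = a + (b + c)" by transfer (simp add: add.assoc)
  show "a + b = b + a" by transfer (simp add: add.commute)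
  show "0 + a = a" by transfer simp
  show "- a + a = 0" by transfer simp
  show "a - b = a + - b" by transfer simp
  show "a * b * c = a * (b * c)" by transfer simp
  show "(a + b) * c = a * c + b * c" by transfer simp
  show "a * (b + c) = a * b + a * c"
    by transfer (simp add: linear_simps(1))
  show "1 * a = a" by transfer simp
  show "a * 1 = a" by transfer simp
  show "k *\<^sub>C (a + b) = k *\<^sub>C a + k *\<^sub>C b" by transfer (simp add: scaleC_add_right)
  show "(k + l) *\<^sub>C a = k *\<^sub>C a + l *\<^sub>C a" by transfer (simp add: scaleC_add_left)
  show "k *\<^sub>C l *\<^sub>C a = (k * l) *\<^sub>C a" by transfer (simp add: scaleC_scaleC)
  show "1 *\<^sub>C a = a" by transfer simp
  show "(k *\<^sub>C a) * b = k *\<^sub>C (a * b)" by transfer simp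
  show "a * (k *\<^sub>C b) = k *\<^sub>C (a * b)" by transfer simp
qed

end

definition is_adjoint :: "'h::complex_hilbert bop \<Rightarrow> 'h bop \<Rightarrow> bool" where
  "is_adjoint a b \<longleftrightarrow> (\<forall>x y. cinner (bop_apply a x) y = cinner x (bop_apply b y))"

definition adj :: "'h::complex_hilbert bop \<Rightarrow> 'h bop" where
  "adj a = (THE b. is_adjoint a b)"

definition selfadjoint :: "'h::complex_hilbert bop \<Rightarrow> bool" where
  "selfadjoint a \<longleftrightarrow> is_adjoint a a"

definition bop_le :: "'h::complex_hilbert bop \<Rightarrow> 'h bop \<Rightarrow> bool" where
  "bop_le a b \<longleftrightarrow> (\<forall>x. cinner (bop_apply (b - a) x) x \<in> \<real>\<^sub>\<ge>\<^sub>0)"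

definition commutant :: "'h::complex_hilbert bop set \<Rightarrow> 'h bop set" where
  "commutant S = {a. \<forall>s\<in>S. a * s = s * a}"

definition von_neumann_algebra :: "'h::complex_hilbert bop set \<Rightarrow> bool" where
  "von_neumann_algebra M \<longleftrightarrow>
     (\<forall>a\<in>M. \<exists>b\<in>M. is_adjoint a b) \<and> commutant (commutant M) = M"


section \<open>Tracial W*-probability spaces\<close>

(* Only the values of tau on M are constrained. *)
definition state_on :: "'h::complex_hilbert bop set \<Rightarrow> ('h bop \<Rightarrow> complex) \<Rightarrow> bool" where
  "state_on M \<tau> \<longleftrightarrow>
     (\<forall>a\<in>M. \<forall>b\<in>M. \<tau> (a + b) = \<tau> a + \<tau> b) \<and>
     (\<forall>c. \<forall>a\<in>M. \<tau> (c *\<^sub>C a) = c * \<tau> a) \<and>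
     (\<forall>a\<in>M. \<tau> (adj a * a) \<in> \<real>\<^sub>\<ge>\<^sub>0) \<and>
     \<tau> 1 = 1"

definition lub_in_sa :: "'h::complex_hilbert bop set \<Rightarrow> 'h bop set \<Rightarrow> 'h bop \<Rightarrow> bool" where
  "lub_in_sa M D s \<longleftrightarrow>
     s \<in> M \<and> selfadjoint s \<and> (\<forall>d\<in>D. bop_le d s) \<and>
     (\<forall>t\<in>M. selfadjoint t \<and> (\<forall>d\<in>D. bop_le d t) \<longrightarrow> bop_le s t)"

(* Normality is order continuity; bounded increasing nets are represented by their
   ranges, which are upward directed sets of self-adjoint elements. *)
definition normal_on :: "'h::complex_hilbert bop set \<Rightarrow> ('h bop \<Rightarrow> complex) \<Rightarrow> bool" where
  "normal_on M \<tau> \<longleftrightarrow>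
     (\<forall>D s. D \<noteq> {} \<and> D \<subseteq> {a \<in> M. selfadjoint a} \<and>
        (\<forall>a\<in>D. \<forall>b\<in>D. \<exists>c\<in>D. bop_le a c \<and> bop_le b c) \<and> lub_in_sa M D s \<longrightarrow>
        Re (\<tau> s) = (SUP d\<in>D. Re (\<tau> d)))"

definition tracial_W_prob_space :: "'h::complex_hilbert bop set \<Rightarrow> ('h bop \<Rightarrow> complex) \<Rightarrow> bool" where
  "tracial_W_prob_space M \<tau> \<longleftrightarrow>
     von_neumann_algebra M \<and> state_on M \<tau> \<and> normal_on M \<tau> \<and>
     (\<forall>a\<in>M. \<forall>b\<in>M. \<tau> (a * b) = \<tau> (b * a)) \<and>
     (\<forall>a\<in>M. \<tau> (adj a * a) = 0 \<longrightarrow> a = 0)"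


section \<open>The completion \<open>L\<^sup>2(M,\<tau>)\<close>\<close>

definition norm2 :: "('h::complex_hilbert bop \<Rightarrow> complex) \<Rightarrow> 'h bop \<Rightarrow> real" where
  "norm2 \<tau> a = sqrt (Re (\<tau> (a * adj a)))"

definition L2_Cauchy ::
  "'h::complex_hilbert bop set \<Rightarrow> ('h bop \<Rightarrow> complex) \<Rightarrow> (nat \<Rightarrow> 'h bop) set" where
  "L2_Cauchy M \<tau> = {u. (\<forall>n. u n \<in> M) \<and>
     (\<forall>e>0. \<exists>N. \<forall>m\<ge>N. \<forall>n\<ge>N. norm2 \<tau> (u m - u n) < e)}"

definition L2_rel ::
  "'h::complex_hilbert bop set \<Rightarrow> ('h bop \<Rightarrow> complex) \<Rightarrow> ((nat \<Rightarrow> 'h bop) \<times> (nat \<Rightarrow> 'h bop)) set"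
  where
  "L2_rel M \<tau> = {(u, v). u \<in> L2_Cauchy M \<tau> \<and> v \<in> L2_Cauchy M \<tau> \<and>
     (\<lambda>n. norm2 \<tau> (u n - v n)) \<longlonglongrightarrow> 0}"

definition L2 ::
  "'h::complex_hilbert bop set \<Rightarrow> ('h bop \<Rightarrow> complex) \<Rightarrow> (nat \<Rightarrow> 'h bop) set set" where
  "L2 M \<tau> = L2_Cauchy M \<tau> // L2_rel M \<tau>"

definition L2_inner ::
  "('h::complex_hilbert bop \<Rightarrow> complex) \<Rightarrow> (nat \<Rightarrow> 'h bop) set \<Rightarrow> (nat \<Rightarrow> 'h bop) set \<Rightarrow> complex"
  where
  "L2_inner \<tau> \<xi> \<eta> = (THE l. \<forall>u\<in>\<xi>. \<forall>v\<in>\<eta>. (\<lambda>n. \<tau> (u n * adj (v n))) \<longlonglongrightarrow> l)"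

definition L2_embed ::
  "'h::complex_hilbert bop set \<Rightarrow> ('h bop \<Rightarrow> complex) \<Rightarrow> 'h bop \<Rightarrow> (nat \<Rightarrow> 'h bop) set" where
  "L2_embed M \<tau> a = L2_rel M \<tau> `` {\<lambda>n. a}"

(* tau(xi a) = <xi, a^*> *)
definition L2_trace ::
  "'h::complex_hilbert bop set \<Rightarrow> ('h bop \<Rightarrow> complex) \<Rightarrow> (nat \<Rightarrow> 'h bop) set \<Rightarrow> 'h bop \<Rightarrow> complex"
  where
  "L2_trace M \<tau> \<xi> a = L2_inner \<tau> \<xi> (L2_embed M \<tau> (adj a))"


section \<open>Algebraic tensor products\<close>

(* The tensor product is the free vector space on pairs modulo the bilinearity relations. *)
abbreviation pure_pair :: "'a \<Rightarrow> 'b \<Rightarrow> ('a \<times> 'b) \<Rightarrow>\<^sub>0 complex" where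
  "pure_pair a b \<equiv> Poly_Mapping.single (a, b) 1"

definition tensor_relators :: "(('a::complex_vector \<times> 'b::complex_vector) \<Rightarrow>\<^sub>0 complex) set" where
  "tensor_relators =
     {pure_pair (a + a') b - pure_pair a b - pure_pair a' b | a a' b. True} \<union>
     {pure_pair a (b + b') - pure_pair a b - pure_pair a b' | a b b'. True} \<union>
     {pure_pair (c *\<^sub>C a) b - c *\<^sub>C pure_pair a b | c a b. True} \<union>
     {pure_pair a (c *\<^sub>C b) - c *\<^sub>C pure_pair a b | c a b. True}"

definition tensor_equiv ::
  "(('a::complex_vector \<times> 'b::complex_vector) \<Rightarrow>\<^sub>0 complex) \<Rightarrow> (('a \<times> 'b) \<Rightarrow>\<^sub>0 complex) \<Rightarrow> bool"
  where "tensor_equiv r s \<longleftrightarrow> r - s \<in> complex_vector.span tensor_relators"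

quotient_type (overloaded) ('a, 'b) tensor =
  "('a::complex_vector \<times> 'b::complex_vector) \<Rightarrow>\<^sub>0 complex" / tensor_equiv
  morphisms rep_tensor tensor_class
proof (rule equivpI)
  show "reflp (tensor_equiv :: (('a \<times> 'b) \<Rightarrow>\<^sub>0 complex) \<Rightarrow> _)"
    by (rule reflpI) (simp add: tensor_equiv_def complex_vector.span_zero)
  show "symp (tensor_equiv :: (('a \<times> 'b) \<Rightarrow>\<^sub>0 complex) \<Rightarrow> _)"
    by (rule sympI) (metis complex_vector.span_neg minus_diff_eq tensor_equiv_def)
  show "transp (tensor_equiv :: (('a \<times> 'b) \<Rightarrow>\<^sub>0 complex) \<Rightarrow> _)"
  proof (rule transpI)
    fix r s t :: "('a \<times> 'b) \<Rightarrow>\<^sub>0 complex"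
    assume "tensor_equiv r s" "tensor_equiv s t"
    then have "(r - s) + (s - t) \<in> complex_vector.span tensor_relators"
      unfolding tensor_equiv_def by (rule complex_vector.span_add)
    then show "tensor_equiv r t"
      by (simp add: tensor_equiv_def)
  qed
qed

instantiation tensor :: (complex_vector, complex_vector) complex_vector
begin

lift_definition zero_tensor :: "('a, 'b) tensor" is 0 .

lift_definition plus_tensor :: "('a, 'b) tensor \<Rightarrow> ('a, 'b) tensor \<Rightarrow> ('a, 'b) tensor" is "(+)"
  unfolding tensor_equiv_def by (simp only: add_diff_add complex_vector.span_add)

lift_definition uminus_tensor :: "('a, 'b) tensor \<Rightarrow> ('a, 'b) tensor" is uminus
  unfolding tensor_equiv_def by (simp only: minus_diff_minus complex_vector.span_neg)

lift_definition minus_tensor :: "('a, 'b) tensor \<Rightarrow> ('a, 'b) tensor \<Rightarrow> ('a, 'b) tensor" is "(-)"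
  unfolding tensor_equiv_def
proof -
  fix r r' s s' :: "('a \<times> 'b) \<Rightarrow>\<^sub>0 complex"
  assume "r - r' \<in> complex_vector.span tensor_relators"
    and "s - s' \<in> complex_vector.span tensor_relators"
  then have "(r - r') - (s - s') \<in> complex_vector.span tensor_relators"
    by (rule complex_vector.span_diff)
  moreover have "(r - s) - (r' - s') = (r - r') - (s - s')"
    by (simp add: algebra_simps)
  ultimately show "(r - s) - (r' - s') \<in> complex_vector.span tensor_relators"
    by (simp only:)
qed

lift_definition scaleC_tensor :: "complex \<Rightarrow> ('a, 'b) tensor \<Rightarrow> ('a, 'b) tensor" is scaleC
  unfolding tensor_equiv_def
  by (simp only: complex_vector.scale_right_diff_distrib[symmetric] complex_vector.span_scale)

instance
proof
  fix t u v :: "('a, 'b) tensor" and k l :: complex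
  have refl: "tensor_equiv r r" for r :: "('a \<times> 'b) \<Rightarrow>\<^sub>0 complex"
    by (simp add: tensor_equiv_def complex_vector.span_zero)
  show "t + u + v = t + (u + v)" by transfer (simp only: add.assoc refl)
  show "t + u = u + t" by transfer (simp only: add.commute refl)
  show "0 + t = t" by transfer (simp only: add_0_left refl)
  show "- t + t = 0" by transfer (simp only: add.left_inverse refl)
  show "t - u = t + - u" by transfer (simp only: diff_conv_add_uminus refl)
  show "k *\<^sub>C (t + u) = k *\<^sub>C t + k *\<^sub>C u"
    by transfer (simp only: scaleC_add_right refl)
  show "(k + l) *\<^sub>C t = k *\<^sub>C t + l *\<^sub>C t"
    by transfer (simp only: scaleC_add_left refl)
  show "k *\<^sub>C l *\<^sub>C t = (k * l) *\<^sub>C t" by transfer (simp only: scaleC_scaleC refl)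
  show "1 *\<^sub>C t = t" by transfer (simp only: scaleC_one refl)
qed

end

definition tensor :: "'a::complex_vector \<Rightarrow> 'b::complex_vector \<Rightarrow> ('a, 'b) tensor"
    (infixr \<open>\<otimes>\<^sub>t\<close> 72)
  where "a \<otimes>\<^sub>t b = tensor_class (pure_pair a b)"

(* For subspaces A and B of the ambient spaces this is (the injective image of) the tensor
   product of A and B. *)
definition tensor_sub ::
  "'a::complex_vector set \<Rightarrow> 'b::complex_vector set \<Rightarrow> ('a, 'b) tensor set" where
  "tensor_sub A B = complex_vector.span {a \<otimes>\<^sub>t b | a b. a \<in> A \<and> b \<in> B}"

(* The linear map on tensor_sub A B induced by h, which is to be bilinear on the subspaces A, B;
   the value then does not depend on the chosen representative over A and B. *)
definition tensor_lift ::
  "'a::complex_vector set \<Rightarrow> 'b::complex_vector set \<Rightarrow> ('a \<Rightarrow> 'b \<Rightarrow> 'v::complex_vector) \<Rightarrow>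
   ('a, 'b) tensor \<Rightarrow> 'v" where
  "tensor_lift A B h t =
     (let r = (SOME r. Poly_Mapping.keys r \<subseteq> A \<times> B \<and> tensor_class r = t)
      in \<Sum>(a, b)\<in>Poly_Mapping.keys r. Poly_Mapping.lookup r (a, b) *\<^sub>C h a b)"

(* a . (b (x) c) . d = ab (x) cd *)
definition bimodule_act ::
  "'a::complex_algebra \<Rightarrow> ('a, 'a) tensor \<Rightarrow> 'a \<Rightarrow> ('a, 'a) tensor" where
  "bimodule_act a t d = tensor_lift UNIV UNIV (\<lambda>b c. (a * b) \<otimes>\<^sub>t (c * d)) t"

(* Derivations from a unital subalgebra A to the bimodule of the algebraic tensor square of A. *)
definition derivation ::
  "'a::complex_algebra set \<Rightarrow> ('a \<Rightarrow> ('a, 'a) tensor) \<Rightarrow> bool" where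
  "derivation A \<delta> \<longleftrightarrow>
     \<delta> \<in> A \<rightarrow>\<^sub>E tensor_sub A A \<and>
     (\<forall>a\<in>A. \<forall>b\<in>A. \<delta> (a + b) = \<delta> a + \<delta> b) \<and>
     (\<forall>c. \<forall>a\<in>A. \<delta> (c *\<^sub>C a) = c *\<^sub>C \<delta> a) \<and>
     (\<forall>a\<in>A. \<forall>b\<in>A. \<delta> (a * b) = bimodule_act 1 (\<delta> a) b + bimodule_act a (\<delta> b) 1)"


section \<open>Non-commutative polynomials\<close>

datatype 'i word = Word (letters: "'i list")

instantiation word :: (type) monoid_add
begin
definition zero_word :: "'a word" where "0 = Word []"
definition plus_word :: "'a word \<Rightarrow> 'a word \<Rightarrow> 'a word"
  where "u + v = Word (letters u @ letters v)"
instance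
  by standard (simp_all add: zero_word_def plus_word_def)
end

(* The monoid algebra of the free monoid; the variables are indexed by 'i, and the ring
   structure is the convolution product of Poly_Mapping. *)
type_synonym 'i ncpoly = "'i word \<Rightarrow>\<^sub>0 complex"

abbreviation monomial :: "'i word \<Rightarrow> 'i ncpoly" where
  "monomial w \<equiv> Poly_Mapping.single w 1"

definition nc_eval :: "('i \<Rightarrow> 'a::complex_algebra) \<Rightarrow> 'i ncpoly \<Rightarrow> 'a" where
  "nc_eval X P =
     (\<Sum>w\<in>Poly_Mapping.keys P. Poly_Mapping.lookup P w *\<^sub>C prod_list (map X (letters w)))"

definition nc_eval2 ::
  "('i \<Rightarrow> 'a::complex_algebra) \<Rightarrow> ('i ncpoly, 'i ncpoly) tensor \<Rightarrow> ('a, 'a) tensor"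
  where "nc_eval2 X = tensor_lift UNIV UNIV (\<lambda>P Q. nc_eval X P \<otimes>\<^sub>t nc_eval X Q)"

definition nc_partial :: "'i \<Rightarrow> 'i ncpoly \<Rightarrow> ('i ncpoly, 'i ncpoly) tensor" where
  "nc_partial j P =
     (\<Sum>w\<in>Poly_Mapping.keys P. Poly_Mapping.lookup P w *\<^sub>C
        (\<Sum>(u, v)\<in>{(u, v). w = u + Word [j] + v}. monomial u \<otimes>\<^sub>t monomial v))"

definition conjugate_relations ::
  "'h::complex_hilbert bop set \<Rightarrow> ('h bop \<Rightarrow> complex) \<Rightarrow> ('i \<Rightarrow> 'h bop) \<Rightarrow>
   ('i \<Rightarrow> (nat \<Rightarrow> 'h bop) set) \<Rightarrow> bool" where
  "conjugate_relations M \<tau> X \<xi> \<longleftrightarrow>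
     (\<forall>P j. tensor_lift M M (\<lambda>a b. \<tau> a * \<tau> b) (nc_eval2 X (nc_partial j P)) =
        L2_trace M \<tau> (\<xi> j) (nc_eval X P))"

end

theory Submission
  imports Defs
begin

text \<open>Write \<open>ev\<close> for the evaluation of polynomials at \<open>X\<close>. The core is that the kernel of \<open>ev\<close> is
  stable under the maps \<open>\<Delta>\<^sub>j = (\<tau> \<circ> ev \<otimes> id) \<circ> \<partial>\<^sub>j\<close>. Let \<open>Q(X) = 0\<close> and let \<open>R\<close> be any
  polynomial. By the Leibniz rule \<open>(\<partial>\<^sub>j(Q R))(X) = (\<partial>\<^sub>j Q)(X) \<cdot> R(X) + Q(X) \<cdot> (\<partial>\<^sub>j R)(X)\<close>, whose last
  term vanishes, so the conjugate relation for \<open>Q R\<close> reads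
  \<open>\<tau>((\<Delta>\<^sub>j Q)(X) R(X)) = \<tau>(\<xi>\<^sub>j Q(X) R(X)) = 0\<close>. The range of \<open>ev\<close> is closed under adjoints because
  the \<open>X\<^sub>i\<close> are self-adjoint; so \<open>R(X)\<close> may be taken to be the adjoint of \<open>(\<Delta>\<^sub>j Q)(X)\<close>, and
  faithfulness of \<open>\<tau>\<close> gives \<open>(\<Delta>\<^sub>j Q)(X) = 0\<close>.

  On the other hand, on the homogeneous part of top degree \<open>\<Delta>\<^sub>j\<close> deletes a leading letter \<open>j\<close>
  (\<open>lookup_slice_partial\<close>), since the other factorizations leave a shorter second factor and
  \<open>\<tau>(1) = 1\<close>. A nonzero \<open>P\<close> of degree \<open>d\<close> with \<open>P(X) = 0\<close> would thus lead after \<open>d\<close> steps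
  to a nonzero constant in the kernel, which is absurd (\<open>eq_zero_if_slices_closed\<close>,
  \<open>no_relations\<close>).

  Consequently \<open>ev\<close> is injective, and \<open>(ev \<otimes> ev) \<circ> \<partial>\<^sub>j \<circ> ev\<inverse>\<close> is the required derivation. It is
  unique, as a derivation vanishes at \<open>1\<close> and is determined by its values on generators.\<close>


section \<open>Complex-linear maps and free vector spaces\<close>

abbreviation clinear :: "('a::complex_vector \<Rightarrow> 'b::complex_vector) \<Rightarrow> bool" where
  "clinear \<equiv> Vector_Spaces.linear scaleC scaleC"

global_interpretation complex_vector_pair:
  vector_space_pair "scaleC :: complex \<Rightarrow> 'a \<Rightarrow> 'a::complex_vector"
    "scaleC :: complex \<Rightarrow> 'b \<Rightarrow> 'b::complex_vector" ..

lemma clinear_iff: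
  "clinear f \<longleftrightarrow> (\<forall>x y. f (x + y) = f x + f y) \<and> (\<forall>c x. f (c *\<^sub>C x) = c *\<^sub>C f x)"
  by (simp add: Vector_Spaces.linear_iff complex_vector.vector_space_axioms)

lemma clinearI:
  assumes "\<And>x y. f (x + y) = f x + f y" and "\<And>c x. f (c *\<^sub>C x) = c *\<^sub>C f x"
  shows "clinear f"
  using assms by (simp add: clinear_iff)

lemma clinear_add: "clinear f \<Longrightarrow> f (x + y) = f x + f y"
  and clinear_scaleC: "clinear f \<Longrightarrow> f (c *\<^sub>C x) = c *\<^sub>C f x"
  by (simp_all add: clinear_iff)

lemmas clinear_0 = complex_vector_pair.linear_0
  and clinear_diff = complex_vector_pair.linear_diff
  and clinear_sum = complex_vector_pair.linear_sum

lemma clinear_compose: "clinear f \<Longrightarrow> clinear g \<Longrightarrow> clinear (\<lambda>x. g (f x))"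
  by (simp add: clinear_iff)

lemma lookup_scaleC: "Poly_Mapping.lookup (c *\<^sub>C p) k = c *\<^sub>C Poly_Mapping.lookup p k"
  by transfer simp

text \<open>The linear map on the free complex vector space over \<open>'k\<close> that sends each basis vector
  \<open>k\<close> to \<open>f k\<close>.\<close>

definition lin_ext :: "('k \<Rightarrow> 'v::complex_vector) \<Rightarrow> ('k \<Rightarrow>\<^sub>0 complex) \<Rightarrow> 'v" where
  "lin_ext f p = (\<Sum>k\<in>Poly_Mapping.keys p. Poly_Mapping.lookup p k *\<^sub>C f k)"

lemma lin_ext_superset:
  assumes "finite S" "Poly_Mapping.keys p \<subseteq> S"
  shows "lin_ext f p = (\<Sum>k\<in>S. Poly_Mapping.lookup p k *\<^sub>C f k)"
  unfolding lin_ext_def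
  by (rule sum.mono_neutral_left) (use assms in \<open>auto simp: in_keys_iff\<close>)

lemma clinear_lin_ext: "clinear (lin_ext f)"
proof (rule clinearI)
  fix p q :: "'a \<Rightarrow>\<^sub>0 complex" and c
  let ?S = "Poly_Mapping.keys p \<union> Poly_Mapping.keys q"
  have "Poly_Mapping.keys (p + q) \<subseteq> ?S"
    by (rule Poly_Mapping.keys_add)
  then show "lin_ext f (p + q) = lin_ext f p + lin_ext f q"
    by (simp add: lin_ext_superset[of ?S] lookup_add scaleC_add_left sum.distrib)
  have "Poly_Mapping.keys (c *\<^sub>C p) \<subseteq> Poly_Mapping.keys p"
    by (auto simp: in_keys_iff lookup_scaleC scaleC_complex_def)
  then show "lin_ext f (c *\<^sub>C p) = c *\<^sub>C lin_ext f p"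
    by (simp add: lin_ext_superset[of "Poly_Mapping.keys p"] lookup_scaleC scaleC_complex_def
        scaleC_scaleC complex_vector.scale_sum_right)
qed

lemma lin_ext_single [simp]: "lin_ext f (Poly_Mapping.single k 1) = f k"
  by (simp add: lin_ext_def scaleC_one)

lemma lin_ext_cong:
  "(\<And>k. k \<in> Poly_Mapping.keys p \<Longrightarrow> f k = g k) \<Longrightarrow> lin_ext f p = lin_ext g p"
  by (simp add: lin_ext_def)

lemma lin_ext_single_id: "lin_ext (\<lambda>k. Poly_Mapping.single k 1) p = p" for p :: "'k \<Rightarrow>\<^sub>0 complex"
proof (rule poly_mapping_eqI)
  fix k
  have "Poly_Mapping.lookup (lin_ext (\<lambda>k. Poly_Mapping.single k 1) p) k =
      (\<Sum>l\<in>Poly_Mapping.keys p. if l = k then Poly_Mapping.lookup p l else 0)"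
    unfolding lin_ext_def lookup_sum
    by (rule sum.cong) (auto simp: lookup_scaleC scaleC_complex_def lookup_single when_def)
  then show "Poly_Mapping.lookup (lin_ext (\<lambda>k. Poly_Mapping.single k 1) p) k =
      Poly_Mapping.lookup p k"
    by (simp add: in_keys_iff)
qed

lemma clinear_apply_lin_ext: "clinear F \<Longrightarrow> F (lin_ext f p) = lin_ext (\<lambda>k. F (f k)) p"
  by (simp add: lin_ext_def clinear_sum clinear_scaleC)

text \<open>Linear maps on polynomials are compared on monomials through this lemma, and products of
  polynomials through its bilinear version below.\<close>

lemma clinear_eq_on_singles:
  fixes p :: "'k \<Rightarrow>\<^sub>0 complex"
  assumes "clinear F" "clinear G"
    and "\<And>k. F (Poly_Mapping.single k 1) = G (Poly_Mapping.single k 1)"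
  shows "F p = G p"
  using clinear_apply_lin_ext[OF assms(1), of "\<lambda>k. Poly_Mapping.single k 1" p]
    clinear_apply_lin_ext[OF assms(2), of "\<lambda>k. Poly_Mapping.single k 1" p] assms(3)
  by (simp add: lin_ext_single_id)

lemma clinear_extends_from_subspace:
  assumes S: "complex_vector.subspace S"
    and add: "\<And>x y. x \<in> S \<Longrightarrow> y \<in> S \<Longrightarrow> f (x + y) = f x + f y"
    and scale: "\<And>c x. x \<in> S \<Longrightarrow> f (c *\<^sub>C x) = c *\<^sub>C f x"
  obtains g where "clinear g" "\<And>x. x \<in> S \<Longrightarrow> g x = f x"
proof -
  obtain B where B: "B \<subseteq> S" "complex_vector.independent B" "S \<subseteq> complex_vector.span B"
    using complex_vector.maximal_independent_subset by blast
  obtain g where g: "clinear g" "\<forall>x\<in>B. g x = f x"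
    using complex_vector_pair.linear_independent_extend[OF B(2)] by blast
  have "x \<in> S \<and> g x = f x" if "x \<in> complex_vector.span B" for x
    using that
  proof (induction rule: complex_vector.span_induct_alt)
    case base
    have "f (0 *\<^sub>C 0) = 0 *\<^sub>C f 0"
      using scale complex_vector.subspace_0[OF S] by blast
    then show ?case
      using complex_vector.subspace_0[OF S] by (simp add: clinear_0[OF g(1)])
  next
    case (step c x y)
    then show ?case
      using B(1) g S add scale
      by (auto simp: clinear_add clinear_scaleC complex_vector.subspace_add
          complex_vector.subspace_scale)
  qed
  then show thesis
    using B(3) g(1) that by blast
qed


section \<open>Maps out of algebraic tensor products\<close>

text \<open>Complex bilinear maps.\<close>

definition bilin :: "('a::complex_vector \<Rightarrow> 'b::complex_vector \<Rightarrow> 'v::complex_vector) \<Rightarrow> bool" where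
  "bilin h \<longleftrightarrow> (\<forall>a. clinear (h a)) \<and> (\<forall>b. clinear (\<lambda>a. h a b))"

lemma bilinI: "(\<And>a. clinear (h a)) \<Longrightarrow> (\<And>b. clinear (\<lambda>a. h a b)) \<Longrightarrow> bilin h"
  by (simp add: bilin_def)

lemma bilin_eq_on_singles:
  fixes p :: "'k \<Rightarrow>\<^sub>0 complex" and q :: "'l \<Rightarrow>\<^sub>0 complex"
  assumes "bilin F" "bilin G"
    and "\<And>k l. F (Poly_Mapping.single k 1) (Poly_Mapping.single l 1) =
      G (Poly_Mapping.single k 1) (Poly_Mapping.single l 1)"
  shows "F p q = G p q"
proof -
  have eq: "F (Poly_Mapping.single k 1) q = G (Poly_Mapping.single k 1) q" for k
    by (rule clinear_eq_on_singles[of "F _" "G _"]) (use assms in \<open>simp_all add: bilin_def\<close>)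
  show ?thesis
    by (rule clinear_eq_on_singles[of "\<lambda>p. F p q" "\<lambda>p. G p q"])
      (use assms in \<open>simp_all add: bilin_def eq\<close>)
qed

text \<open>The linear extension of a bilinear map kills the defining relators, so it factors through
  the tensor product.\<close>

lemma lin_ext_eq_on_tensor_class:
  assumes h: "bilin h" and rs: "tensor_class r = tensor_class s"
  shows "lin_ext (\<lambda>(a, b). h a b) r = lin_ext (\<lambda>(a, b). h a b) s"
proof -
  let ?F = "lin_ext (\<lambda>(a, b). h a b)"
  have F: "clinear ?F"
    by (rule clinear_lin_ext)
  have "r - s \<in> complex_vector.span tensor_relators"
    using rs by (simp add: tensor.abs_eq_iff tensor_equiv_def)
  moreover have "?F x = 0" if "x \<in> tensor_relators" for x
    using that h unfolding tensor_relators_def bilin_def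
    by (auto simp: clinear_diff[OF F] clinear_scaleC[OF F] clinear_add[of "h _"]
        clinear_add[of "\<lambda>a. h a _"] clinear_scaleC[of "h _"] clinear_scaleC[of "\<lambda>a. h a _"])
  ultimately have "?F (r - s) = 0"
    using complex_vector_pair.linear_eq_0_on_span[OF F] by blast
  then show ?thesis
    by (simp add: clinear_diff[OF F])
qed

lemma clinear_tensor_class: "clinear tensor_class"
  by (rule clinearI) (simp_all add: plus_tensor.abs_eq scaleC_tensor.abs_eq)

text \<open>The bilinear map may be prescribed on subspaces only; then a bilinear map on the whole
  spaces that extends it computes the lift of every tensor that lives over these subspaces.\<close>

lemma tensor_lift_tensor_class:
  assumes "bilin h'" and "\<And>a b. a \<in> A \<Longrightarrow> b \<in> B \<Longrightarrow> h a b = h' a b"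
    and "Poly_Mapping.keys r \<subseteq> A \<times> B"
  shows "tensor_lift A B h (tensor_class r) = lin_ext (\<lambda>(a, b). h' a b) r"
proof -
  define s where
    "s = (SOME s. Poly_Mapping.keys s \<subseteq> A \<times> B \<and> tensor_class s = tensor_class r)"
  have s: "Poly_Mapping.keys s \<subseteq> A \<times> B \<and> tensor_class s = tensor_class r"
    unfolding s_def by (rule someI[of _ r]) (simp add: assms(3))
  have "tensor_lift A B h (tensor_class r) = lin_ext (\<lambda>(a, b). h a b) s"
    by (simp add: tensor_lift_def s_def[symmetric] Let_def lin_ext_def case_prod_unfold)
  also have "\<dots> = lin_ext (\<lambda>(a, b). h' a b) s"
    using s assms(2) by (intro lin_ext_cong) auto
  also have "\<dots> = lin_ext (\<lambda>(a, b). h' a b) r"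
    using s by (intro lin_ext_eq_on_tensor_class assms(1)) simp
  finally show ?thesis .
qed

lemma tensor_lift_UNIV_class:
  "bilin h \<Longrightarrow> tensor_lift UNIV UNIV h (tensor_class r) = lin_ext (\<lambda>(a, b). h a b) r"
  by (rule tensor_lift_tensor_class) auto

lemma tensor_class_cases: obtains r where "t = tensor_class r"
  using tensor.abs_induct[of "\<lambda>t. \<exists>r. t = tensor_class r" t] by blast

lemma clinear_tensor_lift:
  fixes h :: "'a::complex_vector \<Rightarrow> 'b::complex_vector \<Rightarrow> 'v::complex_vector"
  assumes "bilin h"
  shows "clinear (tensor_lift UNIV UNIV h)"
proof (rule clinearI)
  fix s t :: "('a, 'b) tensor" and c
  obtain p q where "s = tensor_class p" "t = tensor_class q"
    by (metis tensor_class_cases)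
  then show "tensor_lift UNIV UNIV h (s + t) = tensor_lift UNIV UNIV h s + tensor_lift UNIV UNIV h t"
    and "tensor_lift UNIV UNIV h (c *\<^sub>C s) = c *\<^sub>C tensor_lift UNIV UNIV h s"
    by (simp_all add: tensor_lift_UNIV_class[OF assms] clinear_add[OF clinear_lin_ext]
        clinear_scaleC[OF clinear_lin_ext] plus_tensor.abs_eq scaleC_tensor.abs_eq)
qed

lemma tensor_lift_tensor: "bilin h \<Longrightarrow> tensor_lift UNIV UNIV h (a \<otimes>\<^sub>t b) = h a b"
  by (simp add: tensor_def tensor_lift_UNIV_class)

lemma clinear_eq_on_tensors:
  assumes "clinear F" "clinear G" and "\<And>a b. F (a \<otimes>\<^sub>t b) = G (a \<otimes>\<^sub>t b)"
  shows "F t = G t"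
proof -
  obtain r where r: "t = tensor_class r"
    by (rule tensor_class_cases)
  have "F (tensor_class r) = G (tensor_class r)"
    by (rule clinear_eq_on_singles[of "\<lambda>r. F (tensor_class r)" "\<lambda>r. G (tensor_class r)"])
      (use assms in \<open>auto simp: tensor_def intro: clinear_compose[OF clinear_tensor_class]\<close>)
  then show ?thesis
    by (simp add: r)
qed

lemma tensor_class_eqI: "r - s \<in> tensor_relators \<Longrightarrow> tensor_class r = tensor_class s"
  by (simp add: tensor.abs_eq_iff tensor_equiv_def complex_vector.span_base)

lemma tensor_add_left: "(a + a') \<otimes>\<^sub>t b = a \<otimes>\<^sub>t b + a' \<otimes>\<^sub>t b"
  and tensor_add_right: "a \<otimes>\<^sub>t (b + b') = a \<otimes>\<^sub>t b + a \<otimes>\<^sub>t b'"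
  and tensor_scaleC_left: "(c *\<^sub>C a) \<otimes>\<^sub>t b = c *\<^sub>C (a \<otimes>\<^sub>t b)"
  and tensor_scaleC_right: "a \<otimes>\<^sub>t (c *\<^sub>C b) = c *\<^sub>C (a \<otimes>\<^sub>t b)"
  unfolding tensor_def plus_tensor.abs_eq scaleC_tensor.abs_eq
  by (rule tensor_class_eqI, unfold tensor_relators_def diff_diff_eq[symmetric], blast)+

lemma bilin_tensor: "bilin (\<otimes>\<^sub>t)"
  by (simp add: bilin_def clinear_iff tensor_add_left tensor_add_right tensor_scaleC_left
      tensor_scaleC_right)

lemma tensor_sub_representative:
  assumes "t \<in> tensor_sub A B"
  obtains r where "Poly_Mapping.keys r \<subseteq> A \<times> B" "t = tensor_class r"
proof -
  have "\<exists>r. Poly_Mapping.keys r \<subseteq> A \<times> B \<and> t = tensor_class r"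
    using assms unfolding tensor_sub_def
  proof (induction rule: complex_vector.span_induct_alt)
    case base
    then show ?case
      by (intro exI[of _ 0]) (simp add: zero_tensor_def)
  next
    case (step c x y)
    then obtain a b r where "x = tensor_class (pure_pair a b)" "a \<in> A" "b \<in> B"
      and "y = tensor_class r" "Poly_Mapping.keys r \<subseteq> A \<times> B"
      by (auto simp: tensor_def)
    moreover have "Poly_Mapping.keys (c *\<^sub>C pure_pair a b) \<subseteq> {(a, b)}"
      by (auto simp: in_keys_iff lookup_scaleC lookup_single scaleC_complex_def when_def
          split: if_splits)
    ultimately show ?case
      using Poly_Mapping.keys_add[of "c *\<^sub>C pure_pair a b" r]
      by (intro exI[of _ "c *\<^sub>C pure_pair a b + r"])
        (auto simp: plus_tensor.abs_eq scaleC_tensor.abs_eq)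
  qed
  then show thesis
    using that by blast
qed

lemma tensor_lift_subspaces:
  assumes "bilin h'" and "\<And>a b. a \<in> A \<Longrightarrow> b \<in> B \<Longrightarrow> h a b = h' a b" and "t \<in> tensor_sub A B"
  shows "tensor_lift A B h t = tensor_lift UNIV UNIV h' t"
proof -
  obtain r where "Poly_Mapping.keys r \<subseteq> A \<times> B" "t = tensor_class r"
    using assms(3) by (rule tensor_sub_representative)
  then show ?thesis
    using assms(1,2) by (simp add: tensor_lift_tensor_class[of h'] tensor_lift_UNIV_class)
qed

lemma clinear_image_tensor_sub:
  assumes "clinear F" and "\<And>a b. F (a \<otimes>\<^sub>t b) \<in> tensor_sub A B"
  shows "F t \<in> tensor_sub A B"
proof -
  obtain r where r: "t = tensor_class r"
    by (rule tensor_class_cases)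
  have "F t = lin_ext (\<lambda>(a, b). F (a \<otimes>\<^sub>t b)) r"
    using clinear_apply_lin_ext[OF clinear_compose[OF clinear_tensor_class assms(1)],
        of "\<lambda>k. Poly_Mapping.single k 1" r]
    by (simp add: r lin_ext_single_id tensor_def case_prod_unfold)
  also have "\<dots> \<in> tensor_sub A B"
    unfolding lin_ext_def tensor_sub_def
    by (intro complex_vector.span_sum complex_vector.span_scale)
      (use assms(2) in \<open>auto simp: tensor_sub_def\<close>)
  finally show ?thesis .
qed


section \<open>The bimodule structure\<close>

lemma clinear_mult_left: "clinear (\<lambda>x::'a::complex_algebra. a * x)"
  and clinear_mult_right: "clinear (\<lambda>x::'a::complex_algebra. x * a)"
  by (simp_all add: clinear_iff distrib_left distrib_right mult_scaleC_left mult_scaleC_right)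

lemma bilin_compose:
  assumes "bilin h" "clinear f" "clinear g"
  shows "bilin (\<lambda>a b. h (f a) (g b))"
  using assms
  by (auto simp: bilin_def intro: clinear_compose[of f "\<lambda>a. h a _"] clinear_compose[of g "h _"])

lemma bilin_bimodule: "bilin (\<lambda>b c. (a * b) \<otimes>\<^sub>t (c * d))" for a d :: "'a::complex_algebra"
  by (rule bilin_compose[OF bilin_tensor clinear_mult_left clinear_mult_right])

lemma clinear_bimodule_act: "clinear (\<lambda>t. bimodule_act a t d)"
  unfolding bimodule_act_def by (rule clinear_tensor_lift[OF bilin_bimodule])

lemma bimodule_act_tensor [simp]: "bimodule_act a (b \<otimes>\<^sub>t c) d = (a * b) \<otimes>\<^sub>t (c * d)"
  unfolding bimodule_act_def by (rule tensor_lift_tensor[OF bilin_bimodule])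

lemma bimodule_act_one: "bimodule_act 1 t 1 = t"
  by (rule clinear_eq_on_tensors[OF clinear_bimodule_act complex_vector.linear_ident]) simp

lemma clinear_add_fun: "clinear f \<Longrightarrow> clinear g \<Longrightarrow> clinear (\<lambda>x. f x + g x)"
  by (simp add: clinear_iff scaleC_add_right algebra_simps)

lemma clinear_scaleC_fun: "clinear f \<Longrightarrow> clinear (\<lambda>x. c *\<^sub>C f x)"
  by (simp add: clinear_iff scaleC_add_right scaleC_scaleC mult.commute)

lemma clinear_bimodule_act_right: "clinear (\<lambda>d. bimodule_act a t d)"
proof (rule clinearI)
  fix d d' c
  show "bimodule_act a t (d + d') = bimodule_act a t d + bimodule_act a t d'"
    by (rule clinear_eq_on_tensors[OF clinear_bimodule_act
          clinear_add_fun[OF clinear_bimodule_act clinear_bimodule_act]])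
      (simp add: distrib_left tensor_add_right)
  show "bimodule_act a t (c *\<^sub>C d) = c *\<^sub>C bimodule_act a t d"
    by (rule clinear_eq_on_tensors[OF clinear_bimodule_act
          clinear_scaleC_fun[OF clinear_bimodule_act]])
      (simp add: mult_scaleC_right tensor_scaleC_right)
qed

lemma clinear_bimodule_act_left: "clinear (\<lambda>a. bimodule_act a t d)"
proof (rule clinearI)
  fix a a' c
  show "bimodule_act (a + a') t d = bimodule_act a t d + bimodule_act a' t d"
    by (rule clinear_eq_on_tensors[OF clinear_bimodule_act
          clinear_add_fun[OF clinear_bimodule_act clinear_bimodule_act]])
      (simp add: distrib_right tensor_add_left)
  show "bimodule_act (c *\<^sub>C a) t d = c *\<^sub>C bimodule_act a t d"
    by (rule clinear_eq_on_tensors[OF clinear_bimodule_act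
          clinear_scaleC_fun[OF clinear_bimodule_act]])
      (simp add: mult_scaleC_left tensor_scaleC_left)
qed


section \<open>Evaluation of non-commutative polynomials\<close>

text \<open>The value at \<open>X\<close> of the monomial of a word.\<close>

abbreviation word_eval :: "('i \<Rightarrow> 'a::monoid_mult) \<Rightarrow> 'i word \<Rightarrow> 'a" where
  "word_eval X w \<equiv> prod_list (map X (letters w))"

lemma word_eval_0 [simp]: "word_eval X 0 = 1"
  and word_eval_add [simp]: "word_eval X (u + v) = word_eval X u * word_eval X v"
  by (simp_all add: zero_word_def plus_word_def)

lemma nc_eval_eq_lin_ext: "nc_eval X = lin_ext (word_eval X)"
  by (simp add: fun_eq_iff nc_eval_def lin_ext_def)

lemma clinear_nc_eval: "clinear (nc_eval X)"
  by (simp add: nc_eval_eq_lin_ext clinear_lin_ext)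

lemma nc_eval_monomial [simp]: "nc_eval X (monomial w) = word_eval X w"
  by (simp add: nc_eval_eq_lin_ext)

text \<open>Scalar multiplication of polynomials is multiplication by constants, which are central;
  hence the convolution product is complex bilinear.\<close>

lemma scaleC_eq_const_mult:
  "c *\<^sub>C p = Poly_Mapping.single 0 c * p" for p :: "'k::monoid_add \<Rightarrow>\<^sub>0 complex"
  unfolding mult_map_scale_conv_mult[symmetric]
  by (rule poly_mapping_eqI) (simp add: lookup_scaleC scaleC_complex_def map.rep_eq when_def)

lemma const_mult_commute:
  "Poly_Mapping.single 0 c * p = p * Poly_Mapping.single 0 c"
  for p :: "'k::monoid_add \<Rightarrow>\<^sub>0 complex"
proof (rule clinear_eq_on_singles[where p = p])
  show "clinear (\<lambda>p. Poly_Mapping.single 0 c * p)"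
    by (simp add: scaleC_eq_const_mult[symmetric] complex_vector.linear_scale_self)
  show "clinear (\<lambda>p. p * Poly_Mapping.single 0 c)"
    by (rule clinearI) (simp_all add: distrib_right scaleC_eq_const_mult mult.assoc)
qed (simp add: mult_single)

lemma bilin_ncpoly_mult: "bilin ((*) :: ('k::monoid_add \<Rightarrow>\<^sub>0 complex) \<Rightarrow> _)"
proof -
  have "p * (c *\<^sub>C q) = c *\<^sub>C (p * q)" for p q :: "'k \<Rightarrow>\<^sub>0 complex" and c
    unfolding scaleC_eq_const_mult mult.assoc[symmetric] const_mult_commute[of c p] ..
  then show ?thesis
    by (simp add: bilin_def clinear_iff distrib_left distrib_right scaleC_eq_const_mult mult.assoc)
qed

lemma bilin_post: "bilin h \<Longrightarrow> clinear f \<Longrightarrow> bilin (\<lambda>a b. f (h a b))"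
  by (simp add: bilin_def clinear_iff)

lemma bilin_mult: "bilin ((*) :: 'a::complex_algebra \<Rightarrow> _)"
  by (simp add: bilin_def clinear_mult_left clinear_mult_right)

lemma nc_eval_mult: "nc_eval X (P * Q) = nc_eval X P * nc_eval X Q"
  by (rule bilin_eq_on_singles[OF bilin_post[OF bilin_ncpoly_mult clinear_nc_eval]
        bilin_compose[OF bilin_mult clinear_nc_eval clinear_nc_eval]])
    (simp add: mult_single)

lemma nc_eval_1: "nc_eval X 1 = 1"
  using nc_eval_monomial[of X 0] by simp


section \<open>The evaluated free difference quotients\<close>

lemma bilin_nc_eval2: "bilin (\<lambda>P Q. nc_eval X P \<otimes>\<^sub>t nc_eval X Q)"
  by (rule bilin_compose[OF bilin_tensor clinear_nc_eval clinear_nc_eval])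

lemma clinear_nc_eval2: "clinear (nc_eval2 X)"
  unfolding nc_eval2_def by (rule clinear_tensor_lift[OF bilin_nc_eval2])

lemma nc_eval2_tensor [simp]: "nc_eval2 X (P \<otimes>\<^sub>t Q) = nc_eval X P \<otimes>\<^sub>t nc_eval X Q"
  unfolding nc_eval2_def by (rule tensor_lift_tensor[OF bilin_nc_eval2])

text \<open>The factorizations of a word at an occurrence of the letter \<open>j\<close>, without that letter. For
  a concatenation, the occurrence lies in the first or in the second word; this is the Leibniz
  rule on monomials.\<close>

definition splits :: "'i \<Rightarrow> 'i word \<Rightarrow> ('i word \<times> 'i word) set" where
  "splits j w = {(u, v). w = u + Word [j] + v}"

lemma finite_splits: "finite (splits j w)"
proof -
  have "splits j w \<subseteq> (\<lambda>k. (Word (take k (letters w)), Word (drop (Suc k) (letters w)))) `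
      {..length (letters w)}"
  proof clarify
    fix u v assume "(u, v) \<in> splits j w"
    then show "(u, v) \<in> (\<lambda>k. (Word (take k (letters w)), Word (drop (Suc k) (letters w)))) `
        {..length (letters w)}"
      by (intro image_eqI[of _ _ "length (letters u)"]) (auto simp: splits_def plus_word_def)
  qed
  then show ?thesis
    by (rule finite_subset) simp
qed

lemma splits_add:
  "splits j (w + z) =
    (\<lambda>(u, v). (u, v + z)) ` splits j w \<union> (\<lambda>(u, v). (w + u, v)) ` splits j z"
  (is "_ = ?A \<union> ?B")
proof
  show "splits j (w + z) \<subseteq> ?A \<union> ?B"
  proof (rule subrelI)
    fix u v assume "(u, v) \<in> splits j (w + z)"
    then have "letters w @ letters z = letters u @ j # letters v"
      by (simp add: splits_def plus_word_def)
    then obtain us where "letters w = letters u @ us \<and> us @ letters z = j # letters v \<or>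
        letters w @ us = letters u \<and> letters z = us @ j # letters v"
      unfolding append_eq_append_conv2 by blast
    then consider "letters u = letters w @ us" "letters z = us @ j # letters v"
      | "letters w = letters u @ us" "us @ letters z = j # letters v"
      by auto
    then show "(u, v) \<in> ?A \<union> ?B"
    proof cases
      case 1
      then have "(Word us, v) \<in> splits j z" "u = w + Word us"
        by (auto simp: splits_def plus_word_def intro: word.expand)
      then show ?thesis by force
    next
      case 2
      show ?thesis
      proof (cases us)
        case Nil
        then have "(0, v) \<in> splits j z" "u = w + 0"
          using 2 by (auto simp: splits_def zero_word_def plus_word_def intro: word.expand)
        then show ?thesis by force
      next
        case (Cons x us')
        then have "(u, Word us') \<in> splits j w" "v = Word us' + z"
          using 2 by (auto simp: splits_def plus_word_def intro: word.expand)
        then show ?thesis by force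
      qed
    qed
  qed
  show "?A \<union> ?B \<subseteq> splits j (w + z)"
    by (auto simp: splits_def add.assoc)
qed

lemma splits_add_disjoint:
  "(\<lambda>(u, v). (u, v + z)) ` splits j w \<inter> (\<lambda>(u, v). (w + u, v)) ` splits j z = {}"
  (is "?A \<inter> ?B = {}")
proof -
  have "length (letters (fst x)) < length (letters w)" if "x \<in> ?A" for x
    using that by (auto simp: splits_def plus_word_def)
  moreover have "length (letters w) \<le> length (letters (fst x))" if "x \<in> ?B" for x
    using that by (auto simp: plus_word_def)
  ultimately show ?thesis
    by (force simp flip: not_le)
qed

lemma add_word_cancel:
  fixes u v w :: "'i word"
  shows "w + u = w + v \<longleftrightarrow> u = v" and "u + w = v + w \<longleftrightarrow> u = v"
  by (auto simp: plus_word_def intro: word.expand)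

lemma sum_splits_add:
  "(\<Sum>(u, v)\<in>splits j (w + z). f u v) =
    (\<Sum>(u, v)\<in>splits j w. f u (v + z)) + (\<Sum>(u, v)\<in>splits j z. f (w + u) v)"
proof -
  have inj: "inj_on (\<lambda>x. (fst x, snd x + z)) (splits j w)"
      "inj_on (\<lambda>x. (w + fst x, snd x)) (splits j z)"
    by (auto simp: inj_on_def add_word_cancel)
  show ?thesis
    unfolding splits_add case_prod_unfold
    by (subst sum.union_disjoint)
      (simp_all add: finite_splits splits_add_disjoint[unfolded case_prod_unfold] sum.reindex[OF inj(1)]
        sum.reindex[OF inj(2)] comp_def)
qed

text \<open>The map \<open>(ev\<^sub>X \<otimes> ev\<^sub>X) \<circ> \<partial>\<^sub>j\<close>. It is a derivation over the evaluation homomorphism: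
  see \<open>eval_partial_mult\<close>.\<close>

definition eval_partial ::
  "('i \<Rightarrow> 'a::complex_algebra) \<Rightarrow> 'i \<Rightarrow> 'i ncpoly \<Rightarrow> ('a, 'a) tensor" where
  "eval_partial X j P = nc_eval2 X (nc_partial j P)"

lemma nc_partial_eq_lin_ext:
  "nc_partial j = lin_ext (\<lambda>w. \<Sum>(u, v)\<in>splits j w. monomial u \<otimes>\<^sub>t monomial v)"
  by (simp add: fun_eq_iff nc_partial_def lin_ext_def splits_def)

lemma clinear_eval_partial: "clinear (eval_partial X j)"
  unfolding eval_partial_def nc_partial_eq_lin_ext
  by (rule clinear_compose[OF clinear_lin_ext clinear_nc_eval2])

lemma eval_partial_monomial:
  "eval_partial X j (monomial w) = (\<Sum>(u, v)\<in>splits j w. word_eval X u \<otimes>\<^sub>t word_eval X v)"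
  by (simp add: eval_partial_def nc_partial_eq_lin_ext clinear_sum[OF clinear_nc_eval2]
      case_prod_unfold)

lemma eval_partial_mult:
  fixes P Q :: "'i ncpoly"
  shows "eval_partial X j (P * Q) =
    bimodule_act 1 (eval_partial X j P) (nc_eval X Q) +
    bimodule_act (nc_eval X P) (eval_partial X j Q) 1"
proof (rule bilin_eq_on_singles[where p = P and q = Q])
  show "bilin (\<lambda>P Q. eval_partial X j (P * Q))"
    by (rule bilin_post[OF bilin_ncpoly_mult clinear_eval_partial])
  show "bilin (\<lambda>P Q. bimodule_act 1 (eval_partial X j P) (nc_eval X Q) +
      bimodule_act (nc_eval X P) (eval_partial X j Q) 1)"
    by (intro bilinI clinear_add_fun
        clinear_compose[OF clinear_nc_eval clinear_bimodule_act_right]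
        clinear_compose[OF clinear_nc_eval clinear_bimodule_act_left]
        clinear_compose[OF clinear_eval_partial clinear_bimodule_act])
next
  fix w z :: "'i word"
  show "eval_partial X j (monomial w * monomial z) =
      bimodule_act 1 (eval_partial X j (monomial w)) (nc_eval X (monomial z)) +
      bimodule_act (nc_eval X (monomial w)) (eval_partial X j (monomial z)) 1"
    by (simp add: mult_single eval_partial_monomial sum_splits_add)
      (simp add: clinear_sum[OF clinear_bimodule_act] case_prod_unfold)
qed

lemma splits_single: "splits j (Word [i]) = (if i = j then {(0, 0)} else {})"
  by (auto simp: splits_def plus_word_def zero_word_def Cons_eq_append_conv intro: word.expand)

lemma eval_partial_variable:
  "eval_partial X j (monomial (Word [i])) = (if j = i then 1 \<otimes>\<^sub>t 1 else 0)"
  by (simp add: eval_partial_monomial splits_single)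

lemma eval_partial_in_tensor_sub:
  "eval_partial X j P \<in> tensor_sub (range (nc_eval X)) (range (nc_eval X))"
  unfolding eval_partial_def
  by (rule clinear_image_tensor_sub[OF clinear_nc_eval2])
    (auto simp: tensor_sub_def intro!: complex_vector.span_base)


section \<open>Adjoints\<close>

lemma cinner_add_right: "cinner x (y + z) = cinner x y + cinner x z"
  by (metis cinner_add_left cinner_commute complex_cnj_add)

lemma cinner_scaleC_right: "cinner x (c *\<^sub>C y) = cnj c * cinner x y"
  by (metis cinner_scaleC_left cinner_commute complex_cnj_mult)

lemma cinner_left_cancel:
  assumes "\<And>x. cinner x y = cinner x z"
  shows "y = z"
proof -
  have "cinner (y - z) z + cinner (y - z) (y - z) = cinner (y - z) y"
    by (simp flip: cinner_add_right)
  then have "cinner (y - z) (y - z) = 0"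
    using assms by simp
  then show ?thesis
    by (simp add: cinner_self)
qed

lemma adj_eq:
  assumes "is_adjoint a b"
  shows "adj a = b"
  unfolding adj_def
proof (rule the_equality)
  fix c assume c: "is_adjoint a c"
  have "bop_apply c y = bop_apply b y" for y
    by (rule cinner_left_cancel) (metis assms c is_adjoint_def)
  then show "c = b"
    by (simp add: bop_apply_inject[symmetric] fun_eq_iff)
qed (fact assms)

lemma is_adjoint_sym: "is_adjoint a b \<Longrightarrow> is_adjoint b a"
  unfolding is_adjoint_def by (metis cinner_commute)

lemma cinner_zero [simp]: "cinner 0 x = 0" "cinner x 0 = 0"
  using cinner_add_left[of 0 0 x] cinner_add_right[of x 0 0] by simp_all

lemma is_adjoint_zero: "is_adjoint 0 0"
  and is_adjoint_one: "is_adjoint 1 1"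
  and is_adjoint_add: "is_adjoint a a' \<Longrightarrow> is_adjoint b b' \<Longrightarrow> is_adjoint (a + b) (a' + b')"
  and is_adjoint_scaleC: "is_adjoint a a' \<Longrightarrow> is_adjoint (c *\<^sub>C a) (cnj c *\<^sub>C a')"
  and is_adjoint_mult: "is_adjoint a a' \<Longrightarrow> is_adjoint b b' \<Longrightarrow> is_adjoint (a * b) (b' * a')"
  by (simp_all add: is_adjoint_def zero_bop.rep_eq one_bop.rep_eq plus_bop.rep_eq
      scaleC_bop.rep_eq times_bop.rep_eq cinner_add_left cinner_add_right cinner_scaleC_left
      cinner_scaleC_right)

lemma minus_eq_scaleC: "- x = (-1) *\<^sub>C x" for x :: "'a::complex_vector"
  by (simp add: complex_vector.scale_minus_left scaleC_one)

text \<open>The range of the evaluation at self-adjoint operators is closed under adjoints.\<close>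

lemma nc_eval_has_adjoint:
  assumes "\<And>i. selfadjoint (X i)"
  obtains Q where "is_adjoint (nc_eval X P) (nc_eval X Q)"
proof -
  have word: "is_adjoint (word_eval X w) (word_eval X (Word (rev (letters w))))" for w
  proof (induction w)
    case (Word xs)
    then show ?case
    proof (induction xs)
      case (Cons x xs)
      then show ?case
        using assms[of x] by (simp add: selfadjoint_def is_adjoint_mult)
    qed (simp add: is_adjoint_one)
  qed
  have "\<exists>Q. is_adjoint (\<Sum>w\<in>S. c w *\<^sub>C word_eval X w) (nc_eval X Q)" if "finite S" for S c
    using that
  proof induction
    case empty
    show ?case
      by (intro exI[of _ 0]) (simp add: is_adjoint_zero clinear_0[OF clinear_nc_eval])
  next
    case (insert w S)
    then obtain Q where "is_adjoint (\<Sum>w\<in>S. c w *\<^sub>C word_eval X w) (nc_eval X Q)"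
      by blast
    with insert show ?case
      by (intro exI[of _ "cnj (c w) *\<^sub>C monomial (Word (rev (letters w))) + Q"])
        (simp add: clinear_add[OF clinear_nc_eval] clinear_scaleC[OF clinear_nc_eval]
          is_adjoint_add is_adjoint_scaleC word del: word.sel)
  qed
  from this[of "Poly_Mapping.keys P" "Poly_Mapping.lookup P"] show thesis
    using that by (auto simp: nc_eval_def)
qed


section \<open>Tracial von Neumann algebras\<close>

lemma commutant_subalgebra:
  shows "1 \<in> commutant S" and "0 \<in> commutant S"
    and "a \<in> commutant S \<Longrightarrow> b \<in> commutant S \<Longrightarrow> a + b \<in> commutant S"
    and "a \<in> commutant S \<Longrightarrow> b \<in> commutant S \<Longrightarrow> a * b \<in> commutant S"
    and "a \<in> commutant S \<Longrightarrow> c *\<^sub>C a \<in> commutant S"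
  unfolding commutant_def
  by (simp_all add: distrib_left distrib_right mult_scaleC_left mult_scaleC_right)
    (metis mult.assoc)

text \<open>A von Neumann algebra with a faithful normal tracial state.\<close>

locale tracial_algebra =
  fixes M :: "'h::complex_hilbert bop set" and \<tau> :: "'h bop \<Rightarrow> complex"
  assumes tracial: "tracial_W_prob_space M \<tau>"
begin

lemma bicommutant: "commutant (commutant M) = M"
  using tracial by (simp add: tracial_W_prob_space_def von_neumann_algebra_def)

lemmas subalgebra = commutant_subalgebra[where S = "commutant M", unfolded bicommutant]

lemma subspace_M: "complex_vector.subspace M"
  by (simp add: complex_vector.subspace_def subalgebra)

lemma diff_in: "a \<in> M \<Longrightarrow> b \<in> M \<Longrightarrow> a - b \<in> M"
  by (rule complex_vector.subspace_diff[OF subspace_M])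

lemma adj_M:
  assumes "a \<in> M"
  shows "is_adjoint a (adj a)" and "adj a \<in> M" and "adj (adj a) = a"
proof -
  obtain b where "b \<in> M" "is_adjoint a b"
    using tracial assms
    by (auto simp: tracial_W_prob_space_def von_neumann_algebra_def)
  then show "is_adjoint a (adj a)" and "adj a \<in> M" and "adj (adj a) = a"
    using adj_eq[of a b] adj_eq[OF is_adjoint_sym, of a b] by simp_all
qed

lemma tau_add: "a \<in> M \<Longrightarrow> b \<in> M \<Longrightarrow> \<tau> (a + b) = \<tau> a + \<tau> b"
  and tau_scaleC: "a \<in> M \<Longrightarrow> \<tau> (c *\<^sub>C a) = c * \<tau> a"
  and tau_one: "\<tau> 1 = 1"
  and tau_commute: "a \<in> M \<Longrightarrow> b \<in> M \<Longrightarrow> \<tau> (a * b) = \<tau> (b * a)"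
  and tau_nonneg: "a \<in> M \<Longrightarrow> \<tau> (adj a * a) \<in> \<real>\<^sub>\<ge>\<^sub>0"
  and tau_faithful: "a \<in> M \<Longrightarrow> \<tau> (adj a * a) = 0 \<Longrightarrow> a = 0"
  using tracial by (auto simp: tracial_W_prob_space_def state_on_def)

lemma tau_nonneg_mult_adj: "a \<in> M \<Longrightarrow> \<tau> (a * adj a) \<in> \<real>\<^sub>\<ge>\<^sub>0"
  using tau_nonneg[of a] tau_commute[of a "adj a"] adj_M[of a] by simp

lemma tau_faithful_mult_adj: "a \<in> M \<Longrightarrow> \<tau> (a * adj a) = 0 \<Longrightarrow> a = 0"
  using tau_faithful[of a] tau_commute[of a "adj a"] adj_M[of a] by simp

lemma tau_zero: "\<tau> 0 = 0"
  using tau_scaleC[of 0 0] subalgebra(2) by simp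

lemma one_neq_zero: "(1 :: 'h bop) \<noteq> 0"
  using tau_one tau_zero by auto

text \<open>Positivity of \<open>\<tau>\<close> on \<open>(1 + c a)\<^sup>* (1 + c a)\<close> for \<open>c = 1\<close> and \<open>c = \<i>\<close> makes \<open>\<tau>\<close> hermitian.\<close>

lemma tau_adj:
  assumes a: "a \<in> M"
  shows "\<tau> (adj a) = cnj (\<tau> a)"
proof -
  have "Im (c * \<tau> a + cnj c * \<tau> (adj a)) = 0" for c
  proof -
    let ?x = "1 + c *\<^sub>C a"
    have adj: "adj ?x = 1 + cnj c *\<^sub>C adj a"
      by (intro adj_eq is_adjoint_add is_adjoint_one is_adjoint_scaleC adj_M a)
    have "adj ?x * ?x = 1 + (c *\<^sub>C a + (cnj c *\<^sub>C adj a + (c * cnj c) *\<^sub>C (adj a * a)))"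
      by (simp add: adj distrib_left distrib_right mult_scaleC_left mult_scaleC_right
          scaleC_add_right scaleC_scaleC mult.commute)
    then have "\<tau> (adj ?x * ?x) =
        1 + (c * \<tau> a + (cnj c * \<tau> (adj a) + (c * cnj c) * \<tau> (adj a * a)))"
      using a adj_M(2)[OF a] by (simp add: tau_add tau_scaleC tau_one subalgebra)
    moreover have "Im (\<tau> (adj ?x * ?x)) = 0" "Im (\<tau> (adj a * a)) = 0"
      using tau_nonneg[of ?x] tau_nonneg[of a] a
      by (auto simp: subalgebra nonneg_Reals_def)
    ultimately show ?thesis
      by simp
  qed
  from this[of 1] this[of \<i>] show ?thesis
    by (simp add: complex_eq_iff)
qed

lemma cauchy_schwarz:
  assumes a: "a \<in> M" and b: "b \<in> M"
  shows "cmod (\<tau> (a * adj b)) \<le> norm2 \<tau> a * norm2 \<tau> b"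
proof (cases "b = 0")
  case True
  then show ?thesis
    by (simp add: adj_eq[OF is_adjoint_zero] tau_zero norm2_def)
next
  case False
  note in_M = a b adj_M(2)[OF a] adj_M(2)[OF b] subalgebra
  define z where "z = \<tau> (a * adj b)"
  obtain p where p: "\<tau> (a * adj a) = complex_of_real p" "p \<ge> 0"
    using tau_nonneg_mult_adj[OF a] by (auto elim: nonneg_Reals_cases)
  obtain q where q: "\<tau> (b * adj b) = complex_of_real q" "q \<ge> 0"
    using tau_nonneg_mult_adj[OF b] by (auto elim: nonneg_Reals_cases)
  have "q \<noteq> 0"
    using tau_faithful_mult_adj[OF b] False q by auto
  with q have "q > 0"
    by simp
  have z': "\<tau> (b * adj a) = cnj z"
  proof -
    have "adj (a * adj b) = b * adj a"
      by (intro adj_eq is_adjoint_mult adj_M a is_adjoint_sym[OF adj_M(1)] b)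
    then show ?thesis
      using tau_adj[of "a * adj b"] in_M by (simp add: z_def)
  qed
  \<comment> \<open>With this \<open>c\<close>, the element \<open>a + c b\<close> is the component of \<open>a\<close> orthogonal to \<open>b\<close>.\<close>
  define c where "c = - z / q"
  let ?x = "a + c *\<^sub>C b"
  have adj: "adj ?x = adj a + cnj c *\<^sub>C adj b"
    by (intro adj_eq is_adjoint_add is_adjoint_scaleC adj_M a b)
  have "?x * adj ?x =
      a * adj a + (cnj c *\<^sub>C (a * adj b) + (c *\<^sub>C (b * adj a) + (c * cnj c) *\<^sub>C (b * adj b)))"
    by (simp add: adj distrib_left distrib_right mult_scaleC_left mult_scaleC_right
        scaleC_add_right scaleC_scaleC mult.commute add_ac)
  then have "\<tau> (?x * adj ?x) = p + (cnj c * z + (c * cnj z + (c * cnj c) * q))"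
    using in_M by (simp add: tau_add tau_scaleC p q z' flip: z_def)
  also have "\<dots> = p - z * cnj z / q"
    using \<open>q > 0\<close> by (simp add: c_def field_simps)
  also have "\<dots> = complex_of_real (p - (cmod z)\<^sup>2 / q)"
    by (simp only: of_real_diff of_real_divide complex_norm_square)
  finally have "(cmod z)\<^sup>2 / q \<le> p"
    using tau_nonneg_mult_adj[of ?x] in_M by (simp del: of_real_diff of_real_divide)
  then have "(cmod z)\<^sup>2 \<le> p * q"
    using \<open>q > 0\<close> by (simp add: field_simps)
  then have "cmod z \<le> sqrt (p * q)"
    by (rule real_le_rsqrt)
  then show ?thesis
    by (simp add: norm2_def p q z_def real_sqrt_mult)
qed

lemma norm2_nonneg: "norm2 \<tau> a \<ge> 0" if "a \<in> M"
  using tau_nonneg_mult_adj[OF that] by (auto simp: norm2_def elim: nonneg_Reals_cases)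

lemma norm2_zero: "norm2 \<tau> 0 = 0"
  by (simp add: norm2_def tau_zero)

text \<open>A representative \<open>v\<close> of the zero vector is merely a sequence with \<open>norm2 \<tau> (v n)\<close> tending to
  zero, so that the Cauchy-Schwarz inequality and the boundedness of Cauchy sequences are needed.\<close>

lemma L2_trace_zero:
  assumes "\<xi> \<in> L2 M \<tau>"
  shows "L2_trace M \<tau> \<xi> 0 = 0"
proof -
  obtain u0 where u0: "u0 \<in> L2_Cauchy M \<tau>" "\<xi> = L2_rel M \<tau> `` {u0}"
    using assms by (auto simp: L2_def elim: quotientE)
  then have u0_in: "u0 \<in> \<xi>"
    by (simp add: L2_rel_def norm2_zero)
  have zero_in: "(\<lambda>n. 0) \<in> L2_embed M \<tau> 0"
    by (simp add: L2_embed_def L2_rel_def L2_Cauchy_def norm2_zero subalgebra)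
  have lim: "(\<lambda>n. \<tau> (u n * adj (v n))) \<longlonglongrightarrow> 0" if "u \<in> \<xi>" "v \<in> L2_embed M \<tau> 0" for u v
  proof -
    have u: "u \<in> L2_Cauchy M \<tau>"
      using that u0 by (simp add: L2_rel_def)
    have v: "v n \<in> M" for n
      using that by (simp add: L2_embed_def L2_rel_def L2_Cauchy_def)
    have v0: "(\<lambda>n. norm2 \<tau> (0 - v n)) \<longlonglongrightarrow> 0"
      using that by (simp add: L2_embed_def L2_rel_def)
    have uM: "u n \<in> M" for n
      using u by (simp add: L2_Cauchy_def)
    obtain N where N: "\<And>n. n \<ge> N \<Longrightarrow> norm2 \<tau> (u n - u N) < 1"
    proof -
      have "\<exists>N. \<forall>m\<ge>N. \<forall>n\<ge>N. norm2 \<tau> (u m - u n) < 1"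
        using u by (simp add: L2_Cauchy_def)
      then show thesis
        using that by blast
    qed
    have "cmod (\<tau> (u n * adj (v n))) \<le> (1 + norm2 \<tau> (u N)) * norm2 \<tau> (0 - v n)" if "n \<ge> N" for n
    proof -
      define w where "w = 0 - v n"
      have w: "w \<in> M" "norm2 \<tau> w \<ge> 0"
        using diff_in[OF subalgebra(2) v] by (simp_all add: w_def norm2_nonneg)
      have "adj w = (-1) *\<^sub>C adj (v n)"
        using is_adjoint_scaleC[OF adj_M(1)[OF v], of "-1"]
        unfolding w_def diff_0 minus_eq_scaleC[of "v n"] by (intro adj_eq) simp
      then have "u n * adj (v n) = (-1) *\<^sub>C (u n * adj w)"
        by (simp only: mult_scaleC_right scaleC_scaleC) (simp add: scaleC_one)
      also have "u n * adj w = (u n - u N) * adj w + u N * adj w"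
        by (simp flip: distrib_right)
      finally have eq: "u n * adj (v n) = (-1) *\<^sub>C ((u n - u N) * adj w + u N * adj w)" .
      have in_M: "(u n - u N) * adj w \<in> M" "u N * adj w \<in> M"
        by (intro subalgebra diff_in adj_M uM w)+
      have "\<tau> (u n * adj (v n)) = (-1) * (\<tau> ((u n - u N) * adj w) + \<tau> (u N * adj w))"
        unfolding eq using in_M by (simp only: tau_scaleC tau_add subalgebra)
      then have "cmod (\<tau> (u n * adj (v n))) =
          cmod (\<tau> ((u n - u N) * adj w) + \<tau> (u N * adj w))"
        by (simp only: norm_mult) simp
      also have "\<dots> \<le> norm2 \<tau> (u n - u N) * norm2 \<tau> w + norm2 \<tau> (u N) * norm2 \<tau> w"
        by (intro order_trans[OF norm_triangle_ineq] add_mono cauchy_schwarz diff_in uM w)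
      also have "\<dots> \<le> (1 + norm2 \<tau> (u N)) * norm2 \<tau> w"
        using mult_right_mono[OF less_imp_le[OF N[OF that]] w(2)] by (simp add: algebra_simps)
      finally show ?thesis
        by (simp add: w_def)
    qed
    then have "\<forall>\<^sub>F n in sequentially. norm (\<tau> (u n * adj (v n))) \<le>
        (1 + norm2 \<tau> (u N)) * norm2 \<tau> (0 - v n)"
      by (auto simp: eventually_sequentially)
    then show ?thesis
      by (rule Lim_null_comparison) (use tendsto_mult_right_zero[OF v0] in simp)
  qed
  have "L2_inner \<tau> \<xi> (L2_embed M \<tau> 0) = 0"
    unfolding L2_inner_def
  proof (rule the_equality)
    fix l assume l: "\<forall>u\<in>\<xi>. \<forall>v\<in>L2_embed M \<tau> 0. (\<lambda>n. \<tau> (u n * adj (v n))) \<longlonglongrightarrow> l"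
    show "l = 0"
      by (rule LIMSEQ_unique[OF l[THEN bspec, OF u0_in, THEN bspec, OF zero_in]
            lim[OF u0_in zero_in]])
  qed (use lim in blast)
  then show ?thesis
    by (simp add: L2_trace_def adj_eq[OF is_adjoint_zero])
qed

lemma word_eval_in: "(\<And>i. X i \<in> M) \<Longrightarrow> word_eval X w \<in> M"
proof (induction w)
  case (Word xs)
  then show ?case
    by (induction xs) (simp_all add: subalgebra)
qed

lemma nc_eval_in: "(\<And>i. X i \<in> M) \<Longrightarrow> nc_eval X P \<in> M"
  unfolding nc_eval_def
  by (intro complex_vector.subspace_sum[OF subspace_M] subalgebra word_eval_in)

end


section \<open>Relations among the variables\<close>

lemma lookup_lin_ext:
  "Poly_Mapping.lookup (lin_ext f p) v =
    (\<Sum>w\<in>Poly_Mapping.keys p. Poly_Mapping.lookup p w * Poly_Mapping.lookup (f w) v)"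
  for f :: "'k \<Rightarrow> 'l \<Rightarrow>\<^sub>0 complex"
  by (simp add: lin_ext_def lookup_sum lookup_scaleC scaleC_complex_def)

text \<open>The linear map \<open>(\<phi> \<otimes> id) \<circ> \<partial>\<^sub>j\<close> on polynomials, for a linear functional \<open>\<phi>\<close> whose value on the
  word \<open>w\<close> is \<open>f w\<close>.\<close>

definition slice_partial :: "('i word \<Rightarrow> complex) \<Rightarrow> 'i \<Rightarrow> 'i ncpoly \<Rightarrow> 'i ncpoly" where
  "slice_partial f j = lin_ext (\<lambda>w. \<Sum>(u, v)\<in>splits j w. f u *\<^sub>C monomial v)"

lemma length_letters_add [simp]:
  "length (letters (u + v)) = length (letters u) + length (letters v)"
  by (simp add: plus_word_def)

text \<open>If \<open>P\<close> has degree at most \<open>n + 1\<close>, then a factorization \<open>w = u j v\<close> of one of its words with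
  \<open>v\<close> of length at least \<open>n\<close> has an empty first factor, on which \<open>f\<close> is \<open>1\<close>. In degrees \<open>\<ge> n\<close>,
  the slice therefore only removes a leading letter \<open>j\<close>.\<close>

lemma lookup_slice_partial:
  assumes f: "f 0 = 1"
    and P: "\<And>w. w \<in> Poly_Mapping.keys P \<Longrightarrow> length (letters w) \<le> Suc n"
    and v: "n \<le> length (letters v)"
  shows "Poly_Mapping.lookup (slice_partial f j P) v = Poly_Mapping.lookup P (Word [j] + v)"
proof -
  have "(\<Sum>(u, v')\<in>splits j w. f u * Poly_Mapping.lookup (monomial v') v) =
      (if w = Word [j] + v then 1 else 0)" if w: "w \<in> Poly_Mapping.keys P" for w
  proof -
    have "u = 0" if "(u, v) \<in> splits j w" for u
    proof -
      have "length (letters w) = length (letters u) + 1 + length (letters v)"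
        using that by (simp add: splits_def)
      with P[OF w] v have "length (letters u) = 0"
        by linarith
      then show ?thesis
        by (simp add: zero_word_def word.expand)
    qed
    then have "splits j w \<inter> {x. snd x = v} = (if w = Word [j] + v then {(0, v)} else {})"
      by (auto simp: splits_def) (metis add.left_neutral)
    then have "(\<Sum>x\<in>splits j w \<inter> {x. snd x = v}. f (fst x)) =
        (if w = Word [j] + v then 1 else 0)"
      by (simp add: f)
    moreover have "(\<Sum>(u, v')\<in>splits j w. f u * Poly_Mapping.lookup (monomial v') v) =
        (\<Sum>x\<in>splits j w. if snd x = v then f (fst x) else 0)"
      by (rule sum.cong) (auto simp: lookup_single when_def)
    ultimately show ?thesis
      using sum.inter_restrict[OF finite_splits, of "\<lambda>x. f (fst x)" j w "{x. snd x = v}"]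
      by simp
  qed
  then have "Poly_Mapping.lookup (slice_partial f j P) v =
      (\<Sum>w\<in>Poly_Mapping.keys P. if w = Word [j] + v then Poly_Mapping.lookup P w else 0)"
    unfolding slice_partial_def lookup_lin_ext
    by (intro sum.cong)
      (simp_all add: lookup_sum case_prod_unfold lookup_scaleC scaleC_complex_def)
  then show ?thesis
    by (simp add: in_keys_iff)
qed

text \<open>A nonzero element of \<open>K\<close> of degree \<open>n + 1\<close> would have a slice in \<open>K\<close> that is nonzero of
  degree \<open>n\<close>. Descending to degree \<open>0\<close> gives a nonzero constant in \<open>K\<close>.\<close>

lemma eq_zero_if_slices_closed:
  fixes P :: "'i ncpoly"
  assumes f: "f 0 = 1"
    and const: "\<And>c. c *\<^sub>C 1 \<in> K \<Longrightarrow> c = 0"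
    and closed: "\<And>P j. P \<in> K \<Longrightarrow> slice_partial f j P \<in> K"
    and "P \<in> K"
  shows "P = 0"
proof -
  have "Q = 0" if "Q \<in> K" "\<And>w. w \<in> Poly_Mapping.keys Q \<Longrightarrow> length (letters w) \<le> n" for n Q
    using that
  proof (induction n arbitrary: Q)
    case 0
    have "Q = Poly_Mapping.lookup Q 0 *\<^sub>C 1"
    proof (rule poly_mapping_eqI)
      fix w
      show "Poly_Mapping.lookup Q w = Poly_Mapping.lookup (Poly_Mapping.lookup Q 0 *\<^sub>C 1) w"
      proof (cases "w = 0")
        case False
        then have "letters w \<noteq> []"
          by (auto simp: zero_word_def intro: word.expand)
        then have "w \<notin> Poly_Mapping.keys Q"
          using 0(2) by fastforce
        with False show ?thesis
          by (simp add: in_keys_iff lookup_scaleC scaleC_complex_def lookup_one)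
      qed (simp add: lookup_scaleC scaleC_complex_def lookup_one)
    qed
    with const[of "Poly_Mapping.lookup Q 0"] 0(1) show ?case
      by (metis complex_vector.scale_zero_left)
  next
    case (Suc n)
    have slice: "Poly_Mapping.lookup (slice_partial f j Q) v = Poly_Mapping.lookup Q (Word [j] + v)"
      if "n \<le> length (letters v)" for j v
      by (rule lookup_slice_partial[where f = f, OF f Suc.prems(2) that])
    have "slice_partial f j Q = 0" for j
    proof (rule Suc.IH[OF closed[OF Suc.prems(1)]])
      fix w assume w: "w \<in> Poly_Mapping.keys (slice_partial f j Q)"
      show "length (letters w) \<le> n"
      proof (rule ccontr)
        assume long: "\<not> length (letters w) \<le> n"
        then have "Word [j] + w \<in> Poly_Mapping.keys Q"
          using w slice[of w j] by (simp add: in_keys_iff)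
        from Suc.prems(2)[OF this] long show False
          by simp
      qed
    qed
    then have top: "Poly_Mapping.lookup Q (Word [j] + v) = 0" if "n \<le> length (letters v)" for j v
      using slice[OF that, of j] by simp
    show ?case
    proof (rule Suc.IH[OF Suc.prems(1)])
      fix w assume w: "w \<in> Poly_Mapping.keys Q"
      show "length (letters w) \<le> n"
      proof (rule ccontr)
        assume "\<not> length (letters w) \<le> n"
        then obtain j xs where "letters w = j # xs" "n \<le> length xs"
          by (cases "letters w") auto
        then have "w = Word [j] + Word xs" "n \<le> length (letters (Word xs))"
          by (auto simp: plus_word_def intro: word.expand)
        with top w show False
          by (auto simp: in_keys_iff)
      qed
    qed
  qed
  moreover have "\<exists>n. \<forall>w\<in>Poly_Mapping.keys P. length (letters w) \<le> n"
    using finite_nat_set_iff_bounded_le[of "(\<lambda>w. length (letters w)) ` Poly_Mapping.keys P"]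
    by auto
  ultimately show ?thesis
    using \<open>P \<in> K\<close> by blast
qed

lemma bilin_functional_scaleC:
  "clinear \<phi> \<Longrightarrow> bilin (\<lambda>a b. \<phi> a *\<^sub>C b)"
  by (simp add: bilin_def clinear_iff scaleC_add_right scaleC_add_left scaleC_scaleC
      scaleC_complex_def mult.commute)

lemma tensor_sub_mono: "A \<subseteq> A' \<Longrightarrow> B \<subseteq> B' \<Longrightarrow> tensor_sub A B \<subseteq> tensor_sub A' B'"
  unfolding tensor_sub_def by (intro complex_vector.span_mono) blast

text \<open>The kernel of the evaluation is closed under slicing by \<open>\<tau>\<close>: for \<open>Q\<close> in the kernel and any
  polynomial \<open>R\<close>, the conjugate relation for \<open>Q R\<close> says that \<open>\<tau>(a R(X)) = 0\<close>, where
  \<open>a = (\<tau> \<otimes> id)((\<partial>\<^sub>j Q)(X))\<close> is the evaluated slice.\<close>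

lemma (in tracial_algebra) no_relations:
  fixes X :: "'n \<Rightarrow> 'h bop"
  assumes X: "\<And>i. X i \<in> M" "\<And>i. selfadjoint (X i)"
    and \<xi>: "\<And>i. \<xi> i \<in> L2 M \<tau>"
    and conj: "conjugate_relations M \<tau> X \<xi>"
    and P: "nc_eval X P = 0"
  shows "P = 0"
proof -
  \<comment> \<open>\<open>\<tau>\<close> is linear on \<open>M\<close> only; a linear extension allows for tensors over the whole space.\<close>
  obtain \<phi> where \<phi>: "clinear \<phi>" "\<And>a. a \<in> M \<Longrightarrow> \<phi> a = \<tau> a"
    using clinear_extends_from_subspace[OF subspace_M, of \<tau>] tau_add tau_scaleC
    unfolding scaleC_complex_def by blast
  let ?f = "\<lambda>w. \<phi> (word_eval X w)"
  let ?S = "tensor_lift UNIV UNIV (\<lambda>a b. \<phi> a *\<^sub>C b) :: ('h bop, 'h bop) tensor \<Rightarrow> 'h bop"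
  let ?T = "tensor_lift UNIV UNIV (\<lambda>a b. \<phi> a * \<phi> b)"
  note bilin_S = bilin_functional_scaleC[OF \<phi>(1)]
  note S = clinear_tensor_lift[OF bilin_S] tensor_lift_tensor[OF bilin_S]
  have bilin_T: "bilin (\<lambda>a b. \<phi> a * \<phi> b)"
    using \<phi>(1) by (simp add: bilin_def clinear_iff scaleC_complex_def algebra_simps)
  note T = clinear_tensor_lift[OF bilin_T] tensor_lift_tensor[OF bilin_T]
  have T_eq: "?T (bimodule_act 1 t b) = \<phi> (?S t * b)" for t b
    by (rule clinear_eq_on_tensors[OF clinear_compose[OF clinear_bimodule_act T(1)]
          clinear_compose[OF clinear_compose[OF S(1) clinear_mult_right] \<phi>(1)]])
      (simp add: T(2) S(2) mult_scaleC_left clinear_scaleC[OF \<phi>(1)] scaleC_complex_def)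
  have slice: "nc_eval X (slice_partial ?f j Q) = ?S (eval_partial X j Q)" for j Q
    by (rule clinear_eq_on_singles[where p = Q and
          F = "\<lambda>Q. nc_eval X (slice_partial ?f j Q)" and G = "\<lambda>Q. ?S (eval_partial X j Q)"])
      (simp_all add: slice_partial_def clinear_compose[OF clinear_lin_ext clinear_nc_eval]
        clinear_compose[OF clinear_eval_partial S(1)] eval_partial_monomial case_prod_unfold
        clinear_sum[OF clinear_nc_eval] clinear_scaleC[OF clinear_nc_eval]
        clinear_sum[OF S(1)] S(2))
  have conj': "?T (eval_partial X j Q) = L2_trace M \<tau> (\<xi> j) (nc_eval X Q)" for j Q
  proof -
    have "eval_partial X j Q \<in> tensor_sub M M"
      using eval_partial_in_tensor_sub tensor_sub_mono nc_eval_in[of X] X(1)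
      by (metis (no_types, lifting) image_subsetI subsetD)
    then have "tensor_lift M M (\<lambda>a b. \<tau> a * \<tau> b) (eval_partial X j Q) = ?T (eval_partial X j Q)"
      by (intro tensor_lift_subspaces bilin_T) (simp_all add: \<phi>(2))
    then show ?thesis
      using conj by (simp add: conjugate_relations_def eval_partial_def)
  qed
  show ?thesis
  proof (rule eq_zero_if_slices_closed)
    show "?f 0 = 1"
      using \<phi>(2)[OF subalgebra(1)] tau_one by simp
    show "c = 0" if "c *\<^sub>C 1 \<in> {P. nc_eval X P = 0}" for c
      using that one_neq_zero
      by (simp add: clinear_scaleC[OF clinear_nc_eval] nc_eval_1)
    show "P \<in> {P. nc_eval X P = 0}"
      using P by simp
  next
    fix Q j assume "Q \<in> {P. nc_eval X P = 0}"
    then have Q: "nc_eval X Q = 0"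
      by simp
    let ?a = "nc_eval X (slice_partial ?f j Q)"
    \<comment> \<open>Faithfulness applies once \<open>R(X)\<close> is the adjoint of \<open>a\<close>.\<close>
    obtain R where R: "is_adjoint ?a (nc_eval X R)"
      using nc_eval_has_adjoint X(2) by blast
    have "?T (eval_partial X j (Q * R)) = 0"
      by (simp add: conj' nc_eval_mult Q L2_trace_zero[OF \<xi>])
    moreover have "eval_partial X j (Q * R) = bimodule_act 1 (eval_partial X j Q) (nc_eval X R)"
      by (simp add: eval_partial_mult Q clinear_0[OF clinear_bimodule_act_left])
    ultimately have "\<phi> (?a * nc_eval X R) = 0"
      by (simp add: T_eq slice)
    then have "\<tau> (?a * adj ?a) = 0"
      using \<phi>(2) nc_eval_in[of X] X(1) adj_eq[OF R] subalgebra(4) by simp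
    then have "?a = 0"
      using tau_faithful_mult_adj nc_eval_in[of X] X(1) by blast
    then show "slice_partial ?f j Q \<in> {P. nc_eval X P = 0}"
      by simp
  qed
qed


section \<open>Derivations on the generated algebra\<close>

lemma derivation_exists:
  fixes X :: "'i \<Rightarrow> 'a::complex_algebra" and j :: 'i
  assumes inj: "inj (nc_eval X)"
  defines "\<delta> \<equiv> restrict (\<lambda>a. eval_partial X j (inv (nc_eval X) a)) (range (nc_eval X))"
  shows "derivation (range (nc_eval X)) \<delta>" and "\<delta> (X i) = (if j = i then 1 \<otimes>\<^sub>t 1 else 0)"
proof -
  have eq: "\<delta> (nc_eval X P) = eval_partial X j P" for P
    by (simp add: \<delta>_def inv_f_f[OF inj])
  have "\<delta> (X i) = eval_partial X j (monomial (Word [i]))"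
    using eq[of "monomial (Word [i])"] by simp
  then show "\<delta> (X i) = (if j = i then 1 \<otimes>\<^sub>t 1 else 0)"
    by (simp add: eval_partial_variable)
  have "\<delta> \<in> range (nc_eval X) \<rightarrow>\<^sub>E tensor_sub (range (nc_eval X)) (range (nc_eval X))"
    using eq eval_partial_in_tensor_sub by (auto simp: \<delta>_def inv_f_f[OF inj])
  then show "derivation (range (nc_eval X)) \<delta>"
    unfolding derivation_def
    by (auto simp: eq eval_partial_mult
        clinear_add[OF clinear_nc_eval, symmetric] clinear_add[OF clinear_eval_partial]
        clinear_scaleC[OF clinear_nc_eval, symmetric] clinear_scaleC[OF clinear_eval_partial]
        nc_eval_mult[symmetric])
qed

lemma derivation_unique:
  assumes d: "derivation (range (nc_eval X)) d" and e: "derivation (range (nc_eval X)) e"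
    and gen: "\<And>i. d (X i) = e (X i)"
  shows "d = e"
proof -
  let ?A = "range (nc_eval X)"
  have one: "\<delta> 1 = 0" if "derivation ?A \<delta>" for \<delta>
  proof -
    have "1 \<in> ?A"
      using nc_eval_1[of X] by (metis rangeI)
    then have "\<delta> (1 * 1) = bimodule_act 1 (\<delta> 1) 1 + bimodule_act 1 (\<delta> 1) 1"
      using that unfolding derivation_def by blast
    then show ?thesis
      by (simp add: bimodule_act_one)
  qed
  have word_in: "word_eval X w \<in> ?A" for w
    using nc_eval_monomial[of X w] by (metis rangeI)
  have word: "d (word_eval X w) = e (word_eval X w)" for w
  proof (induction w)
    case (Word xs)
    show ?case
    proof (induction xs)
      case (Cons x xs)
      have in_A: "X x \<in> ?A" "prod_list (map X xs) \<in> ?A"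
        using word_in[of "Word [x]"] word_in[of "Word xs"] by simp_all
      have "\<delta> (X x * prod_list (map X xs)) =
          bimodule_act 1 (\<delta> (X x)) (prod_list (map X xs)) +
          bimodule_act (X x) (\<delta> (prod_list (map X xs))) 1" if "derivation ?A \<delta>" for \<delta>
        using that in_A unfolding derivation_def by blast
      from this[OF d] this[OF e] Cons gen show ?case
        by simp
    qed (simp add: one[OF d] one[OF e])
  qed
  have lin: "clinear (\<lambda>P. \<delta> (nc_eval X P))" if "derivation ?A \<delta>" for \<delta>
    using that unfolding derivation_def
    by (intro clinearI) (simp_all add: clinear_add[OF clinear_nc_eval] clinear_scaleC[OF clinear_nc_eval])
  have "d (nc_eval X P) = e (nc_eval X P)" for P
    by (rule clinear_eq_on_singles[OF lin[OF d] lin[OF e]]) (simp add: word)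
  moreover have "d \<in> extensional ?A" "e \<in> extensional ?A"
    using d e by (auto simp: derivation_def PiE_def)
  ultimately show ?thesis
    by (intro extensionalityI[of d ?A e]) auto
qed


section \<open>Algebraic freeness and the induced derivations\<close>

theorem theorem2p5:
  fixes M :: "'h::complex_hilbert bop set"
    and \<tau> :: "'h bop \<Rightarrow> complex"
    and X :: "'n::finite \<Rightarrow> 'h bop"
    and \<xi> :: "'n \<Rightarrow> (nat \<Rightarrow> 'h bop) set"
  assumes "tracial_W_prob_space M \<tau>"
    and "\<And>i. X i \<in> M"
    and "\<And>i. selfadjoint (X i)"
    and "\<And>i. \<xi> i \<in> L2 M \<tau>"
    and "conjugate_relations M \<tau> X \<xi>"
  shows "(\<nexists>P. P \<noteq> 0 \<and> nc_eval X P = 0) \<and>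
    (\<forall>j. \<exists>!\<delta>. derivation (range (nc_eval X)) \<delta> \<and>
       (\<forall>i. \<delta> (X i) = (if j = i then 1 \<otimes>\<^sub>t 1 else 0)))"
proof -
  interpret tracial_algebra M \<tau>
    by standard (fact assms(1))
  have zero: "P = 0" if "nc_eval X P = 0" for P
    using no_relations[OF assms(2-5) that] .
  have inj: "inj (nc_eval X)"
  proof (rule injI)
    fix P Q assume "nc_eval X P = nc_eval X Q"
    then have "nc_eval X (P - Q) = 0"
      by (simp add: clinear_diff[OF clinear_nc_eval])
    from zero[OF this] show "P = Q"
      by simp
  qed
  have "\<exists>!\<delta>. derivation (range (nc_eval X)) \<delta> \<and>
      (\<forall>i. \<delta> (X i) = (if j = i then 1 \<otimes>\<^sub>t 1 else 0))" for j
  proof (rule ex_ex1I)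
    show "\<exists>\<delta>. derivation (range (nc_eval X)) \<delta> \<and>
        (\<forall>i. \<delta> (X i) = (if j = i then 1 \<otimes>\<^sub>t 1 else 0))"
      using derivation_exists[OF inj] by blast
  qed (auto intro!: derivation_unique)
  with zero show ?thesis
    by blast
qed

end
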